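(* Let $k$ be an algebraically closed field of characteristic not equal to $2$, and let $f_1,f_2,f_3\in k[x_1,\dots,x_n]$ be homogeneous polynomials of degree $2$ whose collective strength is at least $2$. Then $f_1,f_2,f_3$ is a regular sequence. In other words $N(3,2)\le 2$.
   Context: Let $R=k[x_1,\dots,x_n]$ with the standard grading. The strength of a homogeneous element $f\in R$ is the minimal integer $s\ge 0$ such that $f=\sum_{i=1}^{s+1}g_ih_i$ with all $g_i,h_i$ homogeneous of positive degree (or $\infty$ if no such decomposition exists); by convention every constant, including $0$, has strength $-1$. The collective strength of a finite set of homogeneous elements of the same degree is the minimal strength of a nontrivial $k$-linear combination of them. $N(r,d)$ denotes the least integer $N$ such that any $r$ homogeneous polynomials of degree $d$ (in any number of variables) with collective strength at least $N$ form a regular sequence. A regular sequence $y_1,\dots,y_m$ is one with $\langle y_1,\dots,y_m\rangle$ proper and each $y_{i+1}$ a nonzerodivisor modulo $\langle y_1,\dots,y_i\rangle$ ($y_1$ a nonzerodivisor). *)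

theory Defs
  imports "HOL-Library.Poly_Mapping" "HOL-Computational_Algebra.Polynomial"
begin

text \<open>Multivariate polynomials over 'a: finitely supported maps from monomials
(exponent vectors nat =>0 nat, variable x_(i+1) has index i) to coefficients,
with convolution product from Poly_Mapping.\<close>

type_synonym 'a mpoly = "(nat \<Rightarrow>\<^sub>0 nat) \<Rightarrow>\<^sub>0 'a"

definition mdeg :: "(nat \<Rightarrow>\<^sub>0 nat) \<Rightarrow> nat" where
  "mdeg m = (\<Sum>i\<in>Poly_Mapping.keys m. Poly_Mapping.lookup m i)"

definition in_ring :: "nat \<Rightarrow> 'a::zero mpoly \<Rightarrow> bool" where
  "in_ring n p \<longleftrightarrow> (\<forall>m\<in>Poly_Mapping.keys p. Poly_Mapping.keys m \<subseteq> {..<n})"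

text \<open>p is homogeneous of degree d (the zero polynomial is homogeneous of every degree).\<close>
definition homogeneous :: "nat \<Rightarrow> 'a::zero mpoly \<Rightarrow> bool" where
  "homogeneous d p \<longleftrightarrow> (\<forall>m\<in>Poly_Mapping.keys p. mdeg m = d)"

definition hom_pos :: "'a::zero mpoly \<Rightarrow> bool" where
  "hom_pos p \<longleftrightarrow> (\<exists>d>0. homogeneous d p)"

definition is_const :: "'a::zero mpoly \<Rightarrow> bool" where
  "is_const p \<longleftrightarrow> Poly_Mapping.keys p \<subseteq> {0}"

definition const :: "'a::zero \<Rightarrow> 'a mpoly" where
  "const c = Poly_Mapping.single 0 c"

definition strength_le :: "nat \<Rightarrow> 'a::comm_ring_1 mpoly \<Rightarrow> int \<Rightarrow> bool" where
  "strength_le n f s \<longleftrightarrow>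
     (is_const f \<and> -1 \<le> s) \<or>
     (0 \<le> s \<and> (\<exists>g h :: nat \<Rightarrow> 'a mpoly.
        (\<forall>i < nat s + 1. in_ring n (g i) \<and> in_ring n (h i) \<and> hom_pos (g i) \<and> hom_pos (h i)) \<and>
        f = (\<Sum>i < nat s + 1. g i * h i)))"

definition collective_strength_ge :: "nat \<Rightarrow> nat \<Rightarrow> (nat \<Rightarrow> 'a::comm_ring_1 mpoly) \<Rightarrow> int \<Rightarrow> bool" where
  "collective_strength_ge n r f N \<longleftrightarrow>
     (\<forall>c :: nat \<Rightarrow> 'a. (\<exists>i<r. c i \<noteq> 0) \<longrightarrow>
        \<not> strength_le n (\<Sum>i<r. const (c i) * f i) (N - 1))"

definition gen_ideal :: "nat \<Rightarrow> nat \<Rightarrow> (nat \<Rightarrow> 'a::comm_ring_1 mpoly) \<Rightarrow> 'a mpoly set" where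
  "gen_ideal n m f = {(\<Sum>i<m. a i * f i) | a. \<forall>i<m. in_ring n (a i)}"

definition regular_seq :: "nat \<Rightarrow> nat \<Rightarrow> (nat \<Rightarrow> 'a::comm_ring_1 mpoly) \<Rightarrow> bool" where
  "regular_seq n r f \<longleftrightarrow>
     1 \<notin> gen_ideal n r f \<and>
     (\<forall>i<r. \<forall>g. in_ring n g \<longrightarrow> f i * g \<in> gen_ideal n i f \<longrightarrow> g \<in> gen_ideal n i f)"

definition alg_closed :: "'a::field itself \<Rightarrow> bool" where
  "alg_closed _ \<longleftrightarrow> (\<forall>p :: 'a poly. degree p > 0 \<longrightarrow> (\<exists>x. poly p x = 0))"

end

theory Submission
  imports Defs
begin

text \<open>
  Write \<open>I = (f\<^sub>1, f\<^sub>2)\<close>. The strength hypothesis says that no nontrivial combination of the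
  quadrics is a sum of two products of linear forms, and it is enough to see that \<open>I\<close> is prime:
  then \<open>f\<^sub>3 g \<in> I\<close> forces \<open>g \<in> I\<close>, because \<open>f\<^sub>3 \<in> I\<close> would by degree be a linear relation.

  Modulo a linear form \<open>l\<close> no combination of \<open>f\<^sub>1, f\<^sub>2\<close> is a product of linear forms, so these two are
  non-associate irreducible, hence prime, quadrics there, and \<open>l\<close> is a nonzerodivisor modulo \<open>I\<close>.
  Over an algebraically closed field \<open>f\<^sub>1, f\<^sub>2\<close> have a common zero as soon as four variables occur;
  moving it to a coordinate point gives \<open>f\<^sub>i = x l\<^sub>i + q\<^sub>i\<close> with \<open>l\<^sub>i, q\<^sub>i\<close> free of \<open>x\<close>. After
  inverting \<open>l\<^sub>1\<close> one eliminates \<open>x\<close>, and \<open>I\<close> becomes generated by the cubic \<open>l\<^sub>1 q\<^sub>2 - l\<^sub>2 q\<^sub>1\<close> (or by a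
  quadric in the pencil if \<open>l\<^sub>1, l\<^sub>2\<close> are proportional). The cubic has no linear factor, so it is
  irreducible, and it is prime because polynomial rings are factorial.
\<close>

section \<open>Polynomials and evaluation\<close>

text \<open>The bound 2 pays for two products. Reducing modulo a linear form \<open>l\<close> spends
  one, \<open>l * m\<close>; a factorization of what remains of a pencil member would spend the
  other. So modulo any linear form no pencil member is zero or a product. The same count excludes a
  linear factor \<open>m\<close> of the cubic: modulo \<open>m\<close> the relation
  \<open>l1 * q2 = l2 * q1\<close> in a factorial ring makes some pencil member zero or a product.
  Elimination of \<open>x\<close> controls the ideal only after inverting \<open>l1\<close>; that
  \<open>l1\<close> is a nonzerodivisor modulo the ideal brings the result back. Two cases escape
  elimination. With at most three variables, moving a zero of one quadric to a coordinate point
  exhibits that quadric as two products. If \<open>l1\<close> and \<open>l2\<close> both vanish, the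
  quadrics are free of \<open>x\<close> and induction on the number of variables applies. Quotients
  and fractions are avoided: a linear substitution killing \<open>l\<close> stands for the quotient
  by \<open>l\<close>, and powers of \<open>l\<close> stand for the localization.\<close>

abbreviation lookup where "lookup \<equiv> Poly_Mapping.lookup"
abbreviation keys where "keys \<equiv> Poly_Mapping.keys"
abbreviation single where "single \<equiv> Poly_Mapping.single"

section \<open>Ring homomorphisms and polynomials in a given set of variables\<close>

locale rhom =
  fixes f :: "'a::comm_ring_1 \<Rightarrow> 'b::comm_ring_1"
  assumes add: "f (x + y) = f x + f y"
    and mult: "f (x * y) = f x * f y"
    and one: "f 1 = 1"
begin

lemma zero: "f 0 = 0"
  using add[of 0 0] by simp

lemma uminus: "f (- x) = - f x"
  using add[of x "- x"] zero by (simp add: eq_neg_iff_add_eq_0 add.commute)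

lemma minus: "f (x - y) = f x - f y"
  using add[of x "- y"] uminus by simp

lemma power: "f (x ^ n) = f x ^ n"
  by (induction n) (simp_all add: one mult)

lemma sum: "f (sum g S) = (\<Sum>x\<in>S. f (g x))"
  by (induction S rule: infinite_finite_induct) (simp_all add: zero add)

lemma dvd: "x dvd y \<Longrightarrow> f x dvd f y"
  unfolding dvd_def using mult by metis

lemmas hom = add mult one zero uminus minus power

end

text \<open>Arbitrary variable sets generalise the initial segments of \<open>in_ring\<close>: later
  arguments remove one variable at a time, as \<open>V - {a}\<close> or
  \<open>- {x}\<close>.\<close>

definition over :: "nat set \<Rightarrow> 'a::zero mpoly \<Rightarrow> bool" where
  "over V p \<longleftrightarrow> (\<forall>m\<in>keys p. keys m \<subseteq> V)"

definition pvar :: "nat \<Rightarrow> 'a::zero_neq_one mpoly" where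
  "pvar i = single (single i 1) 1"

definition mon :: "(nat \<Rightarrow> 'b::comm_ring_1) \<Rightarrow> (nat \<Rightarrow>\<^sub>0 nat) \<Rightarrow> 'b" where
  "mon v m = (\<Prod>i\<in>keys m. v i ^ lookup m i)"

text \<open>The universal property of the polynomial ring: \<open>h\<close> on coefficients and
  \<open>v\<close> on variables determine one homomorphism. Substitution, evaluation,
  \<open>xpoly\<close> and \<open>grade\<close> are all instances, so their ring laws come from
  \<open>rhom_mev\<close>.\<close>

definition mev :: "('a::comm_ring_1 \<Rightarrow> 'b::comm_ring_1) \<Rightarrow> (nat \<Rightarrow> 'b) \<Rightarrow> 'a mpoly \<Rightarrow> 'b" where
  "mev h v p = (\<Sum>m\<in>keys p. h (lookup p m) * mon v m)"

lemma mon_superset: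
  assumes "finite S" "keys m \<subseteq> S"
  shows "mon v m = (\<Prod>i\<in>S. v i ^ lookup m i)"
  unfolding mon_def using assms
  by (intro prod.mono_neutral_left) (auto simp: in_keys_iff)

lemma mon_add: "mon v (m + n) = mon v m * mon v n"
proof -
  let ?S = "keys m \<union> keys n"
  have "keys (m + n) \<subseteq> ?S" by (rule Poly_Mapping.keys_add)
  then show ?thesis
    by (simp add: mon_superset[of ?S] prod.distrib lookup_add power_add)
qed

lemma mon_zero [simp]: "mon v 0 = 1"
  by (simp add: mon_def)

lemma mon_single [simp]: "mon v (single i k) = v i ^ k"
  by (cases "k = 0") (simp_all add: mon_def)

lemma mpoly_sum_single: "(\<Sum>m\<in>keys p. single m (lookup p m)) = p"
  by (rule poly_mapping_eqI) (auto simp: lookup_sum lookup_single when_def in_keys_iff)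

lemma mev_superset:
  assumes "rhom h" "finite S" "keys p \<subseteq> S"
  shows "mev h v p = (\<Sum>m\<in>S. h (lookup p m) * mon v m)"
  unfolding mev_def using assms
  by (intro sum.mono_neutral_left) (auto simp: in_keys_iff rhom.zero)

lemma mev_add:
  assumes "rhom h"
  shows "mev h v (p + q) = mev h v p + mev h v q"
proof -
  let ?S = "keys p \<union> keys q"
  have "keys (p + q) \<subseteq> ?S" by (rule Poly_Mapping.keys_add)
  then show ?thesis
    by (simp add: mev_superset[OF assms, of ?S] sum.distrib lookup_add rhom.add[OF assms] distrib_right)
qed

lemma mev_single:
  assumes "rhom h"
  shows "mev h v (single m c) = h c * mon v m"
  by (cases "c = 0") (simp_all add: mev_def rhom.zero[OF assms])

lemma mev_sum:
  assumes "rhom h"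
  shows "mev h v (sum g S) = (\<Sum>x\<in>S. mev h v (g x))"
proof -
  have "mev h v 0 = 0" by (simp add: mev_def)
  then show ?thesis
    by (induction S rule: infinite_finite_induct) (simp_all add: mev_add[OF assms])
qed

lemma mev_mult:
  assumes "rhom h"
  shows "mev h v (p * q) = mev h v p * mev h v q"
proof -
  have "p * q = (\<Sum>m\<in>keys p. \<Sum>n\<in>keys q. single (m + n) (lookup p m * lookup q n))"
    by (subst (1 2) mpoly_sum_single[symmetric]) (simp add: sum_product mult_single)
  then have "mev h v (p * q) = (\<Sum>m\<in>keys p. \<Sum>n\<in>keys q. h (lookup p m * lookup q n) * mon v (m + n))"
    by (simp add: mev_sum[OF assms] mev_single[OF assms])
  also have "\<dots> = mev h v p * mev h v q"
    unfolding mev_def sum_product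
    by (intro sum.cong refl) (simp add: rhom.mult[OF assms] mon_add algebra_simps)
  finally show ?thesis .
qed

lemma rhom_mev:
  assumes "rhom h"
  shows "rhom (mev h v)"
proof
  show "mev h v 1 = 1"
    using mev_single[OF assms, of v 0 1] by (simp add: rhom.one[OF assms])
qed (simp_all add: mev_add[OF assms] mev_mult[OF assms])

lemma mev_pvar: "rhom h \<Longrightarrow> mev h v (pvar i) = v i"
  by (simp add: pvar_def mev_single rhom.one)

lemma mev_const: "rhom h \<Longrightarrow> mev h v (const c) = h c"
  by (simp add: const_def mev_single)

interpretation const: rhom "const :: 'a::comm_ring_1 \<Rightarrow> 'a mpoly"
  by unfold_locales (simp_all add: const_def single_add mult_single)

lemma const_eq_iff [simp]: "const a = const b \<longleftrightarrow> a = b"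
  unfolding const_def by (metis lookup_single_eq)

lemma const_eq_0_iff [simp]: "const c = (0::'a::comm_ring_1 mpoly) \<longleftrightarrow> c = 0"
  using const_eq_iff[of c 0] by (simp add: const.zero del: const_eq_iff)

lemma mon_pvar: "mon pvar m = (single m 1 :: 'a::comm_ring_1 mpoly)"
proof -
  have pw: "(pvar i :: 'a mpoly) ^ k = single (single i k) 1" for i k
    by (induction k) (simp_all add: pvar_def mult_single single_add[symmetric])
  have pr: "(\<Prod>i\<in>S. single (g i) 1) = (single (sum g S) 1 :: 'a mpoly)" for g :: "nat \<Rightarrow> nat \<Rightarrow>\<^sub>0 nat" and S
    by (induction S rule: infinite_finite_induct) (simp_all add: mult_single)
  have "(\<Sum>i\<in>keys m. single i (lookup m i)) = m"
    by (rule poly_mapping_eqI) (auto simp: lookup_sum lookup_single when_def in_keys_iff)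
  then show ?thesis by (simp add: mon_def pw pr)
qed

lemma single_conv: "single m c = const c * (mon pvar m :: 'a::comm_ring_1 mpoly)"
  by (simp add: mon_pvar const_def mult_single)

lemma over_const [simp]: "over V (const c)"
  by (auto simp: over_def const_def)

lemma over_zero [simp]: "over V 0"
  by (simp add: over_def)

lemma over_one [simp]: "over V (1 :: 'a::comm_ring_1 mpoly)"
  by (simp add: over_def)

lemma over_pvar [simp]: "over V (pvar i :: 'a::comm_ring_1 mpoly) \<longleftrightarrow> i \<in> V"
  by (simp add: over_def pvar_def)

lemma over_add: "over V p \<Longrightarrow> over V q \<Longrightarrow> over V (p + q :: 'a::comm_ring_1 mpoly)"
  using Poly_Mapping.keys_add[of p q] unfolding over_def by blast

lemma over_mult:
  assumes "over V p" "over V q"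
  shows "over V (p * q :: 'a::comm_ring_1 mpoly)"
  unfolding over_def
proof
  fix m assume "m \<in> keys (p * q)"
  then obtain a b where "m = a + b" "a \<in> keys p" "b \<in> keys q"
    using keys_mult[of p q] by blast
  then show "keys m \<subseteq> V"
    using assms Poly_Mapping.keys_add[of a b] unfolding over_def by blast
qed

lemma over_uminus: "over V p \<Longrightarrow> over V (- p :: 'a::comm_ring_1 mpoly)"
  using over_mult[OF over_const, of V p "-1"] by (simp add: const.uminus const.one)

lemma over_minus: "over V p \<Longrightarrow> over V q \<Longrightarrow> over V (p - q :: 'a::comm_ring_1 mpoly)"
  using over_add[of V p "- q"] over_uminus by auto

lemma over_power: "over V p \<Longrightarrow> over V (p ^ n :: 'a::comm_ring_1 mpoly)"
  by (induction n) (auto intro: over_mult)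

lemma over_sum: "(\<And>x. x \<in> S \<Longrightarrow> over V (g x)) \<Longrightarrow> over V (sum g S :: 'a::comm_ring_1 mpoly)"
  by (induction S rule: infinite_finite_induct) (auto intro: over_add)

lemma over_mono: "over V p \<Longrightarrow> V \<subseteq> W \<Longrightarrow> over W p"
  unfolding over_def by blast

lemmas over_ring = over_add over_mult over_uminus over_minus over_power over_sum

lemma over_finite: "\<exists>V. finite V \<and> over V p"
  by (rule exI[of _ "\<Union>m\<in>keys p. keys m"]) (auto simp: over_def)

text \<open>Polynomials over \<open>V\<close> form the subalgebra generated by the constants and the
  variables in \<open>V\<close>; this spares most later proofs the exponent vectors.\<close>

lemma over_induct [consumes 1, case_names const pvar add mult]:
  fixes p :: "'a::comm_ring_1 mpoly"
  assumes "over V p"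
    and c: "\<And>c. P (const c)"
    and v: "\<And>i. i \<in> V \<Longrightarrow> P (pvar i)"
    and a: "\<And>p q. P p \<Longrightarrow> P q \<Longrightarrow> P (p + q)"
    and m: "\<And>p q. P p \<Longrightarrow> P q \<Longrightarrow> P (p * q)"
  shows "P p"
proof -
  have P1: "P 1" using c[of 1] by (simp add: const.one)
  have P0: "P 0" using c[of 0] by (simp add: const.zero)
  have pw: "P (pvar i ^ k)" if "i \<in> V" for i k
    by (induction k) (auto intro: P1 m v that)
  have mn: "P (mon pvar m)" if "keys m \<subseteq> V" for m
  proof -
    have "P (\<Prod>i\<in>S. pvar i ^ lookup m i)" if "S \<subseteq> V" for S
      using that by (induction S rule: infinite_finite_induct) (auto intro: P1 m pw)
    then show ?thesis using that by (auto simp: mon_def)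
  qed
  have "P (\<Sum>m\<in>S. single m (lookup p m))" if "S \<subseteq> keys p" for S
    using that
  proof (induction S rule: infinite_finite_induct)
    case (insert x F)
    then have "P (single x (lookup p x))"
      using assms(1) unfolding single_conv over_def by (intro m c mn) auto
    then show ?case using insert by (auto intro: a)
  qed (auto intro: P0)
  then show ?thesis using mpoly_sum_single[of p] by (metis order_refl)
qed

lemma over_UNIV [simp]: "over UNIV p"
  by (simp add: over_def)

lemma rhom_eqI:
  assumes "rhom f" "rhom g" "over V p"
    and "\<And>c. f (const c) = g (const c)" "\<And>i. i \<in> V \<Longrightarrow> f (pvar i) = g (pvar i)"
  shows "f p = g p"
  using assms(3)
  by (induction rule: over_induct)
    (simp_all add: assms(4,5) rhom.add[OF assms(1)] rhom.add[OF assms(2)]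
      rhom.mult[OF assms(1)] rhom.mult[OF assms(2)])

lemma rhom_comp: "rhom f \<Longrightarrow> rhom g \<Longrightarrow> rhom (\<lambda>x. f (g x))"
  by (simp add: rhom_def)

lemma rhom_id: "rhom (\<lambda>x. x)"
  by (simp add: rhom_def)

definition subst :: "(nat \<Rightarrow> 'a mpoly) \<Rightarrow> 'a::comm_ring_1 mpoly \<Rightarrow> 'a mpoly" where
  "subst = mev const"

interpretation subst: rhom "subst v" for v :: "nat \<Rightarrow> 'a::comm_ring_1 mpoly"
  unfolding subst_def by (rule rhom_mev[OF const.rhom_axioms])

lemma subst_pvar [simp]: "subst v (pvar i) = v i"
  by (simp add: subst_def mev_pvar const.rhom_axioms)

lemma subst_const [simp]: "subst v (const c) = const c"
  by (simp add: subst_def mev_const const.rhom_axioms)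

lemma subst_id_on: "over V p \<Longrightarrow> (\<And>i. i \<in> V \<Longrightarrow> v i = pvar i) \<Longrightarrow> subst v p = p"
  by (rule rhom_eqI[OF subst.rhom_axioms rhom_id]) simp_all

lemma over_subst: "over V p \<Longrightarrow> (\<And>i. i \<in> V \<Longrightarrow> over W (v i)) \<Longrightarrow> over W (subst v p)"
  by (induction rule: over_induct) (auto simp: subst.hom intro: over_ring)

section \<open>Univariate views: one distinguished variable, and the grading\<close>

definition pconst :: "'a \<Rightarrow> 'a::comm_ring_1 mpoly poly" where
  "pconst c = [:const c:]"

lemma rhom_pconst: "rhom pconst"
  by (simp add: rhom_def pconst_def const.hom one_pCons)

text \<open>The polynomial as a univariate polynomial in \<open>pvar a\<close>, with coefficients free of \<open>pvar a\<close>.\<close>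

definition xpoly :: "nat \<Rightarrow> 'a::comm_ring_1 mpoly \<Rightarrow> 'a mpoly poly" where
  "xpoly a = mev pconst (\<lambda>i. if i = a then [:0, 1:] else [:pvar i:])"

interpretation xpoly: rhom "xpoly a" for a
  unfolding xpoly_def by (rule rhom_mev[OF rhom_pconst])

lemma xpoly_pvar: "xpoly a (pvar i) = (if i = a then [:0, 1:] else [:pvar i:])"
  by (simp add: xpoly_def mev_pvar rhom_pconst)

lemma xpoly_const [simp]: "xpoly a (const c) = [:const c:]"
  by (simp add: xpoly_def mev_const rhom_pconst) (simp add: pconst_def)

lemma rhom_poly: "rhom (\<lambda>p. poly p c)"
  by (simp add: rhom_def)

text \<open>Both sides are homomorphisms in \<open>p\<close>, so generators decide. Having a left
  inverse, \<open>xpoly a\<close> is injective, and degree arguments in the variable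
  \<open>a\<close> lose nothing.\<close>

lemma poly_xpoly [simp]: "poly (xpoly a p) (pvar a) = p"
  by (rule rhom_eqI[OF rhom_comp[OF rhom_poly xpoly.rhom_axioms] rhom_id over_UNIV])
    (simp_all add: xpoly_pvar)

lemma xpoly_eq_iff [simp]: "xpoly a p = xpoly a q \<longleftrightarrow> p = q"
  using poly_xpoly by metis

lemma xpoly_eq_0_iff [simp]: "xpoly a p = 0 \<longleftrightarrow> p = 0"
  using xpoly_eq_iff[of a p 0] by (simp add: xpoly.zero del: xpoly_eq_iff)

lemma over_coeff_xpoly:
  assumes "over V p"
  shows "over (V - {a}) (coeff (xpoly a p) i)"
  using assms
proof (induction arbitrary: i rule: over_induct)
  case (mult p q)
  then show ?case by (auto simp: xpoly.hom coeff_mult intro: over_ring)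
qed (auto simp: xpoly_pvar xpoly.hom coeff_pCons split: nat.split intro: over_ring)

lemma xpoly_free:
  assumes "over V p" "a \<notin> V"
  shows "xpoly a p = [:p:]"
proof -
  have "rhom (\<lambda>p. [:p:] :: 'a mpoly poly)"
    by (simp add: rhom_def one_pCons)
  then show ?thesis
    by (rule rhom_eqI[OF xpoly.rhom_axioms _ assms(1)]) (use assms(2) in \<open>auto simp: xpoly_pvar\<close>)
qed

text \<open>Coefficient \<open>d\<close> of \<open>grade p\<close> is the homogeneous component of \<open>p\<close> of degree \<open>d\<close>.\<close>

definition grade :: "'a::comm_ring_1 mpoly \<Rightarrow> 'a mpoly poly" where
  "grade = mev pconst (\<lambda>i. monom (pvar i) 1)"

interpretation grade: rhom grade
  unfolding grade_def by (rule rhom_mev[OF rhom_pconst])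

lemma grade_pvar: "grade (pvar i) = monom (pvar i) 1"
  by (simp add: grade_def mev_pvar rhom_pconst)

lemma grade_const [simp]: "grade (const c) = [:const c:]"
  by (simp add: grade_def mev_const rhom_pconst) (simp add: pconst_def)

lemma poly_grade [simp]: "poly (grade p) 1 = p"
  by (rule rhom_eqI[OF rhom_comp[OF rhom_poly grade.rhom_axioms] rhom_id over_UNIV])
    (simp_all add: grade_pvar poly_monom)

lemma grade_eq_iff [simp]: "grade p = grade q \<longleftrightarrow> p = q"
  using poly_grade by metis

lemma grade_eq_0_iff [simp]: "grade p = 0 \<longleftrightarrow> p = 0"
  using grade_eq_iff[of p 0] by (simp add: grade.zero del: grade_eq_iff)

lemma grade_single: "grade (single m c) = monom (single m c) (mdeg m)"
proof -
  have "mon (\<lambda>i. monom (pvar i) 1) m = monom (mon pvar m :: 'a mpoly) (mdeg m)"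
  proof -
    have "(\<Prod>i\<in>S. monom (pvar i) 1 ^ lookup m i) = monom (\<Prod>i\<in>S. pvar i ^ lookup m i :: 'a mpoly) (\<Sum>i\<in>S. lookup m i)" for S
      by (induction S rule: infinite_finite_induct)
        (simp_all add: monom_power mult_monom)
    then show ?thesis by (simp add: mon_def mdeg_def)
  qed
  then have "grade (single m c) = [:const c:] * monom (mon pvar m) (mdeg m)"
    unfolding grade_def by (subst mev_single[OF rhom_pconst]) (simp add: pconst_def)
  then show ?thesis by (simp add: single_conv smult_monom)
qed

lemma coeff_grade: "coeff (grade p) d = (\<Sum>m\<in>{m\<in>keys p. mdeg m = d}. single m (lookup p m))"
proof -
  have "grade p = (\<Sum>m\<in>keys p. grade (single m (lookup p m)))"
    by (subst mpoly_sum_single[of p, symmetric]) (simp only: grade.sum)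
  then have "coeff (grade p) d = (\<Sum>m\<in>keys p. if mdeg m = d then single m (lookup p m) else 0)"
    by (simp add: grade_single coeff_sum)
  then show ?thesis by (simp add: sum.inter_filter)
qed

lemma homogeneous_coeff_grade: "homogeneous d (coeff (grade p) d)"
  unfolding homogeneous_def coeff_grade
proof
  fix m assume "m \<in> keys (\<Sum>m\<in>{m \<in> keys p. mdeg m = d}. single m (lookup p m))"
  then obtain m' where "m' \<in> {m \<in> keys p. mdeg m = d}" "m \<in> keys (single m' (lookup p m'))"
    using Poly_Mapping.keys_sum[of "\<lambda>m. single m (lookup p m)"] by blast
  then show "mdeg m = d" by (auto split: if_splits)
qed

text \<open>Since \<open>grade\<close> is a ring homomorphism, closure properties of homogeneity
  reduce to identities for \<open>monom\<close>.\<close>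

lemma homogeneous_iff_grade: "homogeneous d p \<longleftrightarrow> grade p = monom p d"
proof
  assume h: "homogeneous d p"
  show "grade p = monom p d"
  proof (rule poly_eqI)
    fix i
    have "{m\<in>keys p. mdeg m = i} = (if i = d then keys p else {})"
      using h by (auto simp: homogeneous_def)
    then show "coeff (grade p) i = coeff (monom p d) i"
      by (simp add: coeff_grade mpoly_sum_single)
  qed
next
  assume "grade p = monom p d"
  then show "homogeneous d p" using homogeneous_coeff_grade[of d p] by simp
qed

section \<open>Factoriality\<close>

text \<open>Split off the largest power of the variable from each factor. The cofactors have nonzero
  constant terms, so the product has a nonzero coefficient at \<open>m + n\<close>, forcing
  \<open>m + n = d\<close>; comparing degrees then leaves constant cofactors.\<close>

lemma monom_factor:
  fixes A B :: "'a::idom poly"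
  assumes "A * B = monom c d" "c \<noteq> 0"
  obtains a b i j where "A = monom a i" "B = monom b j" "i + j = d"
proof -
  have AB: "A \<noteq> 0" "B \<noteq> 0" using assms by auto
  have split: "\<exists>A' n. A = monom 1 n * A' \<and> coeff A' 0 \<noteq> 0" if A0: "A \<noteq> 0" for A :: "'a poly"
  proof -
    obtain A' where A': "A = [:- 0, 1:] ^ order 0 A * A'" "\<not> [:- 0, 1:] dvd A'"
      using order_decomp[OF A0, of 0] by blast
    then have "coeff A' 0 \<noteq> 0" using poly_eq_0_iff_dvd[of A' 0] by (simp add: poly_0_coeff_0)
    moreover have "[:- 0, 1:] ^ n = monom (1::'a) n" for n by (simp add: monom_altdef)
    ultimately show ?thesis using A'(1) by metis
  qed
  obtain A' m where A': "A = monom 1 m * A'" "coeff A' 0 \<noteq> 0" using split[OF AB(1)] by blast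
  obtain B' n where B': "B = monom 1 n * B'" "coeff B' 0 \<noteq> 0" using split[OF AB(2)] by blast
  have e: "monom 1 (m + n) * (A' * B') = monom c d"
    using assms(1) mult_monom[of "1::'a" m 1 n] by (simp add: A' B' algebra_simps)
  have "coeff (monom 1 (m + n) * (A' * B')) (m + n) \<noteq> 0"
    using A' B' by (simp add: coeff_monom_mult coeff_mult_0)
  then have d: "m + n = d" unfolding e by (auto split: if_splits)
  have nz: "A' \<noteq> 0" "B' \<noteq> 0" using A' B' by auto
  have "degree (monom (1::'a) (m + n)) + degree (A' * B') = degree (monom c d)"
    unfolding e[symmetric] using nz by (subst degree_mult_eq[of _ "A' * B'"]) (auto simp: monom_eq_0_iff)
  then have "degree A' = 0" "degree B' = 0"
    using d assms(2) nz by (simp_all add: degree_monom_eq degree_mult_eq)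
  then obtain a b where "A' = [:a:]" "B' = [:b:]" by (meson degree_eq_zeroE)
  then have "A = monom a m" "B = monom b n" using A' B' by (simp_all add: smult_monom)
  then show ?thesis using that d by blast
qed

lemma homogeneous_factor:
  fixes u v :: "'a::idom mpoly"
  assumes "homogeneous d (u * v)" "u * v \<noteq> 0"
  obtains i j where "homogeneous i u" "homogeneous j v" "i + j = d"
proof -
  have "grade u * grade v = monom (u * v) d"
    using assms by (simp add: homogeneous_iff_grade grade.hom)
  then obtain a b i j where e: "grade u = monom a i" "grade v = monom b j" "i + j = d"
    using monom_factor assms(2) by metis
  then have "u = a" "v = b" using poly_grade[of u] poly_grade[of v] by (simp_all add: poly_monom)
  then show ?thesis using that e by (simp add: homogeneous_iff_grade)
qed

lemma homogeneous_0_iff: "homogeneous 0 p \<longleftrightarrow> (\<exists>c. p = const c)"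
proof
  assume h: "homogeneous 0 p"
  have "keys p \<subseteq> {0}"
  proof
    fix m assume "m \<in> keys p"
    then have "mdeg m = 0" using h by (auto simp: homogeneous_def)
    then have "\<forall>i. lookup m i = 0" unfolding mdeg_def by (simp add: in_keys_iff)
    then have "m = 0" by (intro poly_mapping_eqI) simp
    then show "m \<in> {0}" by simp
  qed
  then have "p = single 0 (lookup p 0)"
    by (intro poly_mapping_eqI) (auto simp: lookup_single when_def in_keys_iff)
  then show "\<exists>c. p = const c" unfolding const_def by blast
qed (auto simp: homogeneous_def const_def mdeg_def split: if_splits)

definition tdeg :: "'a::comm_ring_1 mpoly \<Rightarrow> nat" where
  "tdeg p = degree (grade p)"

lemma tdeg_mult: "p \<noteq> 0 \<Longrightarrow> q \<noteq> 0 \<Longrightarrow> tdeg (p * q) = tdeg p + tdeg (q :: 'a::idom mpoly)"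
  by (simp add: tdeg_def grade.hom degree_mult_eq)

lemma tdeg_homogeneous: "homogeneous d p \<Longrightarrow> p \<noteq> 0 \<Longrightarrow> tdeg p = d"
  by (simp add: tdeg_def homogeneous_iff_grade degree_monom_eq)

lemma tdeg_0_iff: "tdeg p = 0 \<longleftrightarrow> (\<exists>c. p = const c)"
proof
  assume "tdeg p = 0"
  then obtain q where q: "grade p = [:q:]" unfolding tdeg_def by (meson degree_eq_zeroE)
  then have "p = q" using poly_grade[of p] by simp
  then have "homogeneous 0 p" using q by (simp add: homogeneous_iff_grade monom_0)
  then show "\<exists>c. p = const c" by (simp add: homogeneous_0_iff)
qed (auto simp: tdeg_def)

lemma const_dvd_1: "c \<noteq> 0 \<Longrightarrow> const c dvd (1 :: 'a::field mpoly)"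
  by (rule dvdI[of _ _ "const (inverse c)"]) (simp add: const.mult[symmetric] const.one)

lemma unit_iff: "(p :: 'a::field mpoly) dvd 1 \<longleftrightarrow> p \<noteq> 0 \<and> tdeg p = 0"
proof
  assume "p dvd 1"
  then obtain q where q: "p * q = 1" by (metis dvdE)
  then have "p \<noteq> 0" "q \<noteq> 0" by auto
  moreover have "tdeg (1 :: 'a mpoly) = 0" by (simp add: tdeg_def grade.one)
  ultimately show "p \<noteq> 0 \<and> tdeg p = 0" using tdeg_mult[of p q] q by simp
next
  assume "p \<noteq> 0 \<and> tdeg p = 0"
  then show "p dvd 1" by (auto simp: tdeg_0_iff const.zero intro: const_dvd_1)
qed

text \<open>In a domain, degrees in a single variable add up. For each variable outside
  \<open>V\<close> the product has degree 0, hence so has the factor.\<close>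

lemma over_factor:
  fixes u v :: "'a::idom mpoly"
  assumes "over V (u * v)" "u * v \<noteq> 0"
  shows "over V u"
proof -
  have free: "over (- {a}) u" if "a \<notin> V" for a
  proof -
    have "xpoly a u * xpoly a v = [:u * v:]"
      using xpoly_free[OF assms(1) that] by (simp add: xpoly.hom)
    then have "degree (xpoly a u * xpoly a v) = 0" by simp
    then have "degree (xpoly a u) = 0" using assms(2) by (simp add: degree_mult_eq)
    then obtain c where c: "xpoly a u = [:c:]" by (meson degree_eq_zeroE)
    then have "c = u" using poly_xpoly[of a u] by simp
    then show ?thesis using over_coeff_xpoly[OF over_UNIV, of a u 0] c by (simp add: Compl_eq_Diff_UNIV)
  qed
  show ?thesis
    unfolding over_def
  proof (intro ballI subsetI, rule ccontr)
    fix m a assume "m \<in> keys u" "a \<in> keys m" "a \<notin> V"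
    then show False using free[of a] by (auto simp: over_def)
  qed
qed

lemma over_dvd:
  fixes u :: "'a::idom mpoly"
  assumes "u dvd p" "over V p" "p \<noteq> 0"
  shows "over V u"
  using assms over_factor by (metis dvdE)

lemma over_insert_free:
  assumes "over V p" "degree (xpoly a p) = 0"
  shows "over (V - {a}) p"
proof -
  obtain c where c: "xpoly a p = [:c:]" using assms(2) by (meson degree_eq_zeroE)
  then have "c = p" using poly_xpoly[of a p] by simp
  then show ?thesis using over_coeff_xpoly[OF assms(1), of a 0] c by simp
qed

section \<open>Irreducible polynomials are prime, by induction on the variables\<close>

lemma irreducible_factor:
  fixes r :: "'a::field mpoly"
  assumes "r \<noteq> 0" "\<not> r dvd 1"
  obtains p where "irreducible p" "p dvd r"
proof -
  let ?P = "\<lambda>d. \<not> d dvd 1 \<and> d dvd r"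
  have "?P r" using assms by simp
  then obtain p where p: "?P p" "\<And>d. ?P d \<Longrightarrow> tdeg p \<le> tdeg d"
    using ex_has_least_nat[of ?P r tdeg] by blast
  have p0: "p \<noteq> 0" using p assms by auto
  have "irreducible p"
  proof (rule irreducibleI)
    fix a b assume e: "p = a * b"
    show "a dvd 1 \<or> b dvd 1"
    proof (rule ccontr)
      assume n: "\<not> (a dvd 1 \<or> b dvd 1)"
      then have "tdeg p \<le> tdeg a" using p e by (metis dvd_mult_left)
      then have "tdeg b = 0" using e p0 tdeg_mult[of a b] by auto
      then show False using n e p0 unit_iff[of b] by auto
    qed
  qed (use p p0 in auto)
  then show ?thesis using that p by blast
qed

text \<open>Primality tested only on polynomials over \<open>U\<close>, so that it can be proved by
  induction on the variable set. Divisibility is that of the whole ring, which by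
  \<open>over_factor\<close> changes nothing for nonzero products over \<open>U\<close>.\<close>

definition relprime_elem :: "nat set \<Rightarrow> 'a::comm_ring_1 mpoly \<Rightarrow> bool" where
  "relprime_elem U p \<longleftrightarrow> (\<forall>g h. over U g \<longrightarrow> over U h \<longrightarrow> p dvd g * h \<longrightarrow> p dvd g \<or> p dvd h)"

lemma dvd_iff_coeff_xpoly:
  fixes p g :: "'a::idom mpoly"
  assumes "over W p" "a \<notin> W"
  shows "p dvd g \<longleftrightarrow> (\<forall>i. p dvd coeff (xpoly a g) i)"
proof
  assume "p dvd g"
  then have "[:p:] dvd xpoly a g" using xpoly.dvd[of p g a] xpoly_free[OF assms] by metis
  then show "\<forall>i. p dvd coeff (xpoly a g) i" by (simp add: const_poly_dvd_iff)
next
  assume "\<forall>i. p dvd coeff (xpoly a g) i"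
  then have "p dvd poly (xpoly a g) (pvar a)"
    by (simp add: poly_altdef dvd_sum dvd_mult2)
  then show "p dvd g" by simp
qed

text \<open>Modulo \<open>p\<close>, polynomials in \<open>a\<close> have coefficients in a domain,
  so the lowest coefficients not divisible by \<open>p\<close> have a product not divisible by
  \<open>p\<close>.\<close>

lemma relprime_elem_insert:
  fixes p :: "'a::idom mpoly"
  assumes p: "over W p" "relprime_elem W p" and a: "a \<notin> W" "U - {a} \<subseteq> W"
  shows "relprime_elem U p"
  unfolding relprime_elem_def
proof (intro allI impI, rule ccontr)
  fix g h assume gh: "over U g" "over U h" "p dvd g * h" and n: "\<not> (p dvd g \<or> p dvd h)"
  let ?G = "\<lambda>i. coeff (xpoly a g) i" and ?H = "\<lambda>i. coeff (xpoly a h) i"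
  have ex: "\<exists>i. \<not> p dvd ?G i" "\<exists>i. \<not> p dvd ?H i"
    using n dvd_iff_coeff_xpoly[OF p(1) a(1)] by blast+
  define i where "i = (LEAST i. \<not> p dvd ?G i)"
  define j where "j = (LEAST j. \<not> p dvd ?H j)"
  have i: "\<not> p dvd ?G i" "\<And>k. k < i \<Longrightarrow> p dvd ?G k"
    unfolding i_def using LeastI_ex[OF ex(1)] not_less_Least by blast+
  have j: "\<not> p dvd ?H j" "\<And>k. k < j \<Longrightarrow> p dvd ?H k"
    unfolding j_def using LeastI_ex[OF ex(2)] not_less_Least by blast+
  \<comment> \<open>In this coefficient every summand except \<open>?G i * ?H j\<close> has a factor
    of index below \<open>i\<close> or below \<open>j\<close>, which \<open>p\<close>
    divides.\<close>
  have "p dvd coeff (xpoly a (g * h)) (i + j)"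
    using gh(3) dvd_iff_coeff_xpoly[OF p(1) a(1)] by blast
  also have "coeff (xpoly a (g * h)) (i + j) = (\<Sum>k\<le>i + j. ?G k * ?H (i + j - k))"
    by (simp add: xpoly.hom coeff_mult)
  also have "\<dots> = ?G i * ?H j + (\<Sum>k\<in>{..i + j} - {i}. ?G k * ?H (i + j - k))"
    by (subst sum.remove[of _ i]) auto
  finally have "p dvd ?G i * ?H j + (\<Sum>k\<in>{..i + j} - {i}. ?G k * ?H (i + j - k))" .
  moreover have "p dvd (\<Sum>k\<in>{..i + j} - {i}. ?G k * ?H (i + j - k))"
  proof (rule dvd_sum)
    fix k assume "k \<in> {..i + j} - {i}"
    then have "k < i \<or> i + j - k < j" by auto
    then show "p dvd ?G k * ?H (i + j - k)" using i j by auto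
  qed
  ultimately have "p dvd ?G i * ?H j" by (simp add: dvd_add_left_iff)
  moreover have "over W (?G i)" "over W (?H j)"
    using over_coeff_xpoly[OF gh(1)] over_coeff_xpoly[OF gh(2)] over_mono a(2) by blast+
  ultimately show False using p(2) i(1) j(1) unfolding relprime_elem_def by blast
qed

text \<open>Ordinary division would invert the leading coefficient of \<open>r\<close>; multiplying
  \<open>F\<close> by it instead stays among polynomials, at the price of a multiplier free of
  \<open>a\<close>.\<close>

lemma pseudo_division:
  fixes F r :: "'a::idom mpoly"
  assumes "over U r" "r \<noteq> 0" "over U F"
  shows "\<exists>c q s. over (U - {a}) c \<and> c \<noteq> 0 \<and> over U q \<and> over U s \<and> c * F = q * r + s
    \<and> (s = 0 \<or> degree (xpoly a s) < degree (xpoly a r))"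
  using assms(3)
proof (induction "degree (xpoly a F)" arbitrary: F rule: less_induct)
  case less
  let ?d = "\<lambda>p. degree (xpoly a p)"
  show ?case
  proof (cases "F = 0 \<or> ?d F < ?d r")
    case True
    then show ?thesis using less.prems
      by (intro exI[of _ 1] exI[of _ 0] exI[of _ F]) auto
  next
    case False
    define b where "b = lead_coeff (xpoly a r)"
    define e where "e = lead_coeff (xpoly a F)"
    define k where "k = ?d F - ?d r"
    have ov: "over (U - {a}) b" "over (U - {a}) e"
      unfolding b_def e_def using over_coeff_xpoly assms(1) less.prems by blast+
    have b0: "b \<noteq> 0" using assms(2) by (simp add: b_def)
    have xb: "xpoly a b = [:b:]" "xpoly a e = [:e:]"
      using xpoly_free ov by blast+
    \<comment> \<open>For \<open>a\<close> outside \<open>U\<close> the degrees in \<open>a\<close>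
      are 0, so \<open>k = 0\<close> and \<open>t\<close> is 1; thus \<open>t\<close> never leaves
      \<open>U\<close>.\<close>
    define t where "t = (if k = 0 \<and> a \<notin> U then 1 else pvar a ^ k :: 'a mpoly)"
    have aU: "k = 0" if "a \<notin> U"
      using xpoly_free[OF less.prems that] by (simp add: k_def)
    have ot: "over U t" using aU by (cases "a \<in> U") (auto simp: t_def intro!: over_power)
    have xt: "xpoly a t = monom 1 k"
      by (auto simp: t_def xpoly.hom xpoly_pvar monom_altdef)
    have ovU: "over U b" "over U e" using ov over_mono[of "U - {a}" _ U] by auto
    define F' where "F' = b * F - e * t * r"
    have oF': "over U F'" unfolding F'_def
      using ovU ot assms(1) less.prems by (intro over_ring)
    have xF': "xpoly a F' = smult b (xpoly a F) - smult e (monom 1 k * xpoly a r)"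
      by (simp add: F'_def xpoly.hom xb xt)
    have "\<exists>c q s. over (U - {a}) c \<and> c \<noteq> 0 \<and> over U q \<and> over U s \<and> c * F' = q * r + s
      \<and> (s = 0 \<or> ?d s < ?d r)"
    proof (cases "F' = 0")
      case True
      then show ?thesis by (intro exI[of _ 1] exI[of _ 0]) auto
    next
      case F'0: False
      show ?thesis
      proof (cases "?d F = 0")
        case True
        \<comment> \<open>No degree is left to lose: here \<open>r\<close> is itself free of
          \<open>a\<close> and serves as the multiplier, with quotient \<open>F'\<close> and
          remainder 0.\<close>
        then have dr: "?d r = 0" using False by auto
        have "over (U - {a}) r" using over_insert_free[OF assms(1) dr] .
        then show ?thesis using assms(2) oF'
          by (intro exI[of _ r] exI[of _ F'] exI[of _ 0]) (auto simp: mult.commute)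
      next
        case dF: False
        have m0: "xpoly a r \<noteq> 0" using assms(2) by simp
        have kd: "k + ?d r = ?d F" using False by (auto simp: k_def)
        have c0: "coeff (xpoly a F') (?d F) = 0"
          unfolding xF' using kd
          by (simp add: coeff_monom_mult b_def e_def flip: kd)
        have "degree (monom 1 k * xpoly a r) = ?d F"
          using m0 kd by (simp add: degree_mult_eq degree_monom_eq monom_eq_0_iff)
        then have "?d F' \<le> ?d F"
          unfolding xF' by (intro degree_diff_le) (auto intro: order.trans[OF degree_smult_le])
        then have "?d F' < ?d F"
          using c0 F'0 by (metis leading_coeff_0_iff le_neq_implies_less xpoly_eq_0_iff)
        then show ?thesis using less.hyps oF' by blast
      qed
    qed
    then obtain c q s where cqs: "over (U - {a}) c" "c \<noteq> 0" "over U q" "over U s"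
      "c * F' = q * r + s" "s = 0 \<or> ?d s < ?d r" by blast
    have "over (U - {a}) (c * b) \<and> c * b \<noteq> 0 \<and> over U (q + c * e * t) \<and> over U s
      \<and> (c * b) * F = (q + c * e * t) * r + s \<and> (s = 0 \<or> ?d s < ?d r)"
      using cqs ov b0 ovU ot over_mono[of "U - {a}" c U]
      by (auto intro!: over_ring simp: F'_def algebra_simps)
    then show ?thesis by blast
  qed
qed

lemma irreducible_not_zero_unit: "irreducible p \<Longrightarrow> p \<noteq> 0 \<and> \<not> p dvd 1"
  by (simp add: irreducible_def)

lemma dvd_unit_mult_cancel:
  assumes "c dvd 1" "q dvd c * (z :: 'a::comm_semiring_1)"
  shows "q dvd z"
proof -
  obtain d where d: "1 = c * d" using assms(1) by (rule dvdE)
  then have "z = c * z * d" by (metis mult.assoc mult.commute mult.right_neutral)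
  then show ?thesis using assms(2) by (metis dvd_mult2)
qed

text \<open>Each nonunit sheds an irreducible factor and loses total degree. These factors lie over
  \<open>W\<close>, so \<open>rel\<close> makes them prime for products over \<open>U\<close>; this
  is how the multipliers left by pseudo-division are removed.\<close>

lemma prime_factor_induct [consumes 3, case_names unit factor]:
  fixes c :: "'a::field mpoly"
  assumes "over W c" "c \<noteq> 0"
    and rel: "\<forall>p :: 'a mpoly. over W p \<longrightarrow> irreducible p \<longrightarrow> relprime_elem U p"
    and unit: "\<And>c. c dvd 1 \<Longrightarrow> P c"
    and factor: "\<And>(p :: 'a mpoly) c. over W p \<Longrightarrow> irreducible p \<Longrightarrow> relprime_elem U p \<Longrightarrow> over W c \<Longrightarrow> c \<noteq> 0 \<Longrightarrow> P c \<Longrightarrow> P (p * c)"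
  shows "P c"
  using assms(1,2)
proof (induction "tdeg c" arbitrary: c rule: less_induct)
  case less
  show ?case
  proof (cases "c dvd 1")
    case False
    obtain p where p: "irreducible p" "p dvd c" using irreducible_factor[OF less.prems(2) False] .
    then obtain d where d: "c = p * d" by (metis dvdE)
    have nz: "p \<noteq> 0" "d \<noteq> 0" using d less.prems by auto
    have ov: "over W p" "over W d"
      using over_dvd[of _ c W] d less.prems by auto
    have "tdeg p \<noteq> 0" using irreducible_not_zero_unit[OF p(1)] unit_iff[of p] by auto
    then have "P d" using less.hyps[of d] ov nz d tdeg_mult[of p d] by auto
    then show ?thesis
      unfolding d by (intro factor ov nz p(1) rel[rule_format])
  qed (rule unit)
qed

text \<open>Write \<open>c * z = q * w\<close>. A prime factor \<open>p\<close> of \<open>c\<close>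
  divides \<open>q\<close> or \<open>w\<close>; if it divided the irreducible \<open>q\<close>, the
  two would be associates and \<open>q\<close> would lie over \<open>W\<close>. So \<open>p\<close>
  divides \<open>w\<close> and can be cancelled.\<close>

lemma irreducible_dvd_cancel_over:
  fixes c :: "'a::field mpoly"
  assumes "over W c" "c \<noteq> 0"
    and rel: "\<forall>p :: 'a mpoly. over W p \<longrightarrow> irreducible p \<longrightarrow> relprime_elem U p"
    and q: "irreducible q" "over U q" "\<not> over W q" and z: "over U z" "q dvd c * z"
    and WU: "W \<subseteq> U"
  shows "q dvd z"
  using assms(1,2,3) z
proof (induction arbitrary: z rule: prime_factor_induct[where U = U and W = W])
  case (unit c)
  then show ?case
    by (intro dvd_unit_mult_cancel[of c q z])
next
  case (factor p c)
  obtain w where w: "p * c * z = q * w" using factor.prems(2) by (rule dvdE)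
  show ?case
  proof (cases "z = 0")
    case False
    have nz: "p \<noteq> 0" "q \<noteq> 0" using irreducible_not_zero_unit factor.hyps(2) q(1) by blast+
    then have "w \<noteq> 0" using w False factor.hyps by auto
    have "over U (q * w)"
      unfolding w[symmetric]
      by (intro over_mult over_mono[OF factor.hyps(1) WU] over_mono[OF factor.hyps(4) WU] factor.prems)
    then have ow: "over U w" using over_factor[of U w q] \<open>w \<noteq> 0\<close> nz by (simp add: mult.commute)
    have "p dvd q * w" unfolding w[symmetric] by simp
    then have "p dvd q \<or> p dvd w" using factor.hyps(3) q(2) ow unfolding relprime_elem_def by blast
    moreover have "\<not> p dvd q"
    proof
      assume "p dvd q"
      then obtain u where u: "q = p * u" by (metis dvdE)
      then have "u dvd 1" using irreducibleD[OF q(1) u] irreducible_not_zero_unit[OF factor.hyps(2)] by blast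
      then have "q dvd p" using u dvd_unit_mult_cancel[of u q p] by (simp add: mult.commute)
      then show False using over_dvd[of q p W] factor.hyps(1) nz q(3) by blast
    qed
    ultimately obtain w' where "w = p * w'" unfolding dvd_def by blast
    then have "p * (c * z) = p * (q * w')" using w by (simp add: algebra_simps)
    then have "c * z = q * w'" using nz by simp
    then show ?thesis using factor.IH[OF factor.prems(1)] by simp
  qed simp
qed

text \<open>The prime factors of \<open>c\<close> are removed from \<open>q * r\<close> one by one;
  those that come out of \<open>r\<close> are collected in \<open>b\<close>, which therefore lies
  over \<open>W\<close>.\<close>

lemma factor_split_over:
  fixes c :: "'a::field mpoly"
  assumes "over W c" "c \<noteq> 0"
    and rel: "\<forall>p :: 'a mpoly. over W p \<longrightarrow> irreducible p \<longrightarrow> relprime_elem U p"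
    and z: "over U q" "over U r" "q \<noteq> 0" "r \<noteq> 0" "c * f = q * r"
  shows "\<exists>q' r' b. f = q' * r' \<and> r = b * r' \<and> over W b"
  using assms(1,2,3) z
proof (induction arbitrary: q r rule: prime_factor_induct[where U = U and W = W])
  case (unit c)
  then obtain d where d: "c * d = 1" by (auto elim!: dvdE)
  have "f = d * (c * f)" using d by (simp add: mult.assoc[symmetric] mult.commute[of d])
  then have "f = (d * q) * r" using unit.prems(5) by (simp add: mult.assoc)
  then show ?case by (intro exI[of _ "d * q"] exI[of _ r] exI[of _ 1]) auto
next
  case (factor p c)
  have p0: "p \<noteq> 0" using irreducible_not_zero_unit[OF factor.hyps(2)] by blast
  have "p dvd q * r" unfolding factor.prems(5)[symmetric] by (simp add: mult.assoc)
  then consider "p dvd q" | "p dvd r"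
    using factor.hyps(3) factor.prems(1,2) unfolding relprime_elem_def by blast
  then show ?case
  proof cases
    case 1
    then obtain q1 where q1: "q = p * q1" by (metis dvdE)
    then have "c * f = q1 * r" using factor.prems(5) p0 by (simp add: mult.assoc)
    moreover have "over U q1" "q1 \<noteq> 0" using q1 factor.prems(1,3) over_dvd[of q1 q U] by auto
    ultimately show ?thesis using factor.IH[OF _ factor.prems(2) _ factor.prems(4)] by blast
  next
    case 2
    then obtain r1 where r1: "r = p * r1" by (metis dvdE)
    then have "p * (c * f) = p * (q * r1)" using factor.prems(5) by (simp add: algebra_simps)
    then have "c * f = q * r1" using p0 by simp
    moreover have "over U r1" "r1 \<noteq> 0" using r1 factor.prems(2,4) over_dvd[of r1 r U] by auto
    ultimately obtain q' r' b where "f = q' * r'" "r1 = b * r'" "over W b"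
      using factor.IH[OF factor.prems(1) _ factor.prems(3)] by blast
    then show ?thesis using r1 factor.hyps(1)
      by (intro exI[of _ q'] exI[of _ r'] exI[of _ "p * b"]) (auto intro: over_mult)
  qed
qed

text \<open>
  Gauss's lemma: with \<open>U = W \<union> {a}\<close>, take \<open>r\<close> of minimal \<open>a\<close>-degree in the ideal generated by \<open>p\<close>
  and \<open>g\<close>. Pseudo-division shows that \<open>r\<close> divides \<open>p\<close> and \<open>g\<close> up to factors over \<open>W\<close>, and those
  factors can be cancelled because they are products of primes by induction.
\<close>

lemma irreducible_relprime_elem:
  fixes p :: "'a::field mpoly"
  assumes "finite U" "over U p" "irreducible p"
  shows "relprime_elem U p"
  using assms
proof (induction "card U" arbitrary: U p rule: less_induct)
  case less
  have p0: "p \<noteq> 0" and pnu: "\<not> p dvd 1" using irreducible_not_zero_unit[OF less.prems(3)] by blast+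
  have "\<exists>m\<in>keys p. keys m \<noteq> {}"
  proof (rule ccontr)
    assume "\<not> ?thesis"
    then have "homogeneous 0 p" by (auto simp: homogeneous_def mdeg_def)
    then obtain c where c: "p = const c" by (auto simp: homogeneous_0_iff)
    then have "c \<noteq> 0" using p0 by simp
    then show False using pnu const_dvd_1[of c] c by simp
  qed
  then obtain m a where ma: "m \<in> keys p" "a \<in> keys m" by blast
  then have aU: "a \<in> U" using less.prems by (auto simp: over_def)
  define W where "W = U - {a}"
  have WU: "W \<subseteq> U" "a \<notin> W" by (auto simp: W_def)
  have npW: "\<not> over W p" using ma by (auto simp: over_def W_def)
  have cW: "card W < card U" unfolding W_def by (rule card_Diff1_less[OF less.prems(1) aU])
  have fW: "finite W" using less.prems(1) by (simp add: W_def)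
  have rel: "\<forall>q :: 'a mpoly. over W q \<longrightarrow> irreducible q \<longrightarrow> relprime_elem U q"
  proof (intro allI impI)
    fix q :: "'a mpoly" assume q: "over W q" "irreducible q"
    show "relprime_elem U q"
      by (rule relprime_elem_insert[OF q(1) less.hyps[OF cW fW q] WU(2)]) (simp add: W_def)
  qed
  note cancel = irreducible_dvd_cancel_over[OF _ _ rel less.prems(3,2) npW _ _ WU(1)]
  let ?d = "\<lambda>p. degree (xpoly a p)"
  have dp: "?d p \<noteq> 0" using over_insert_free[OF less.prems(2)] npW by (auto simp: W_def)
  show ?case
    unfolding relprime_elem_def
  proof (intro allI impI)
    fix g h assume gh: "over U g" "over U h" "p dvd g * h"
    define J where "J = (\<lambda>r. r \<noteq> 0 \<and> (\<exists>u v. over U u \<and> over U v \<and> r = u * p + v * g))"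
    have "J p" unfolding J_def using p0 by (intro conjI exI[of _ 1] exI[of _ 0]) auto
    then obtain r where r: "J r" and rmin: "\<And>s. J s \<Longrightarrow> ?d r \<le> ?d s"
      using ex_has_least_nat[of J p ?d] by blast
    obtain u v where uv: "over U u" "over U v" "r = u * p + v * g" and r0: "r \<noteq> 0"
      using r unfolding J_def by blast
    have oR: "over U r" using uv gh less.prems by (auto intro: over_ring)
    have div: "\<exists>c q. over W c \<and> c \<noteq> 0 \<and> over U q \<and> c * (u1 * p + v1 * g) = q * r"
      if uv1: "over U u1" "over U v1" for u1 v1
    proof -
      have "over U (u1 * p + v1 * g)" using uv1 gh less.prems by (auto intro: over_ring)
      from pseudo_division[OF oR r0 this, of a]
      obtain c q s where cqs: "over W c" "c \<noteq> 0" "over U q"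
        "c * (u1 * p + v1 * g) = q * r + s" "s = 0 \<or> ?d s < ?d r"
        unfolding W_def by blast
      have "s = c * (u1 * p + v1 * g) - q * (u * p + v * g)" using cqs(4) uv(3) by simp
      then have "s = (c * u1 - q * u) * p + (c * v1 - q * v) * g" by (simp add: algebra_simps)
      moreover have "over U (c * u1 - q * u)" "over U (c * v1 - q * v)"
        using cqs uv uv1 over_mono[OF cqs(1) WU(1)] by (auto intro!: over_ring)
      ultimately have "s \<noteq> 0 \<Longrightarrow> J s" unfolding J_def by blast
      then have "s = 0" using cqs(5) rmin by force
      then show ?thesis using cqs by auto
    qed
    obtain c1 q1 where 1: "over W c1" "c1 \<noteq> 0" "over U q1" "c1 * p = q1 * r"
      using div[of 1 0] by auto
    obtain c2 q2 where 2: "over W c2" "c2 \<noteq> 0" "over U q2" "c2 * g = q2 * r"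
      using div[of 0 1] by auto
    have "q1 \<noteq> 0" using 1 p0 by auto
    then obtain q' r' b where qr: "p = q' * r'" "r = b * r'" "over W b"
      using factor_split_over[OF 1(1,2) rel 1(3) oR _ r0 1(4)] by blast
    \<comment> \<open>If \<open>q'\<close> is a unit, \<open>p\<close> is associate to
      \<open>r'\<close>, which divides \<open>r\<close> and hence \<open>c2 * g\<close>. If
      \<open>r'\<close> is a unit, \<open>r\<close> is free of \<open>a\<close>, and
      \<open>r * h\<close> lies in the ideal of \<open>p\<close> and \<open>g * h\<close>, so
      \<open>p\<close> divides it. In both cases the factor over \<open>W\<close> cancels.\<close>
    consider "q' dvd 1" | "r' dvd 1" using less.prems(3) qr(1) irreducibleD by blast
    then show "p dvd g \<or> p dvd h"
    proof cases
      case 1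
      then have "p dvd r'" using qr(1) dvd_unit_mult_cancel[of q' p r'] by simp
      then have "p dvd c2 * g" unfolding 2(4) qr(2) by auto
      then show ?thesis using cancel[OF 2(1,2) gh(1)] by blast
    next
      case 2
      have "over W r'" using 2 over_dvd[of r' 1 W] by auto
      then have oW: "over W r" using qr by (auto intro: over_mult)
      have "r * h = p * (u * h) + v * (g * h)" using uv(3) by (simp add: algebra_simps)
      then have "p dvd r * h" using gh(3) by simp
      then show ?thesis using cancel[OF oW r0 gh(2)] by blast
    qed
  qed
qed

text \<open>Three polynomials use only finitely many variables, so the statement for finite
  \<open>U\<close> applies.\<close>

lemma irreducible_imp_prime_elem_mpoly:
  fixes p :: "'a::field mpoly"
  assumes "irreducible p"
  shows "prime_elem p"
proof (rule prime_elemI)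
  fix g h assume d: "p dvd g * h"
  obtain A B C where "finite A" "over A p" "finite B" "over B g" "finite C" "over C h"
    using over_finite by metis
  then have ov: "finite (A \<union> B \<union> C)" "over (A \<union> B \<union> C) p" "over (A \<union> B \<union> C) g" "over (A \<union> B \<union> C) h"
    by (auto intro: over_mono)
  show "p dvd g \<or> p dvd h"
    using irreducible_relprime_elem[OF ov(1,2) assms] ov(3,4) d unfolding relprime_elem_def by simp
qed (use irreducible_not_zero_unit[OF assms] in simp_all)

section \<open>Pencils of quadrics modulo a linear form\<close>

lemma homogeneous_add: "homogeneous d p \<Longrightarrow> homogeneous d q \<Longrightarrow> homogeneous d (p + q :: 'a::comm_ring_1 mpoly)"
  by (simp add: homogeneous_iff_grade grade.hom add_monom)

lemma homogeneous_uminus: "homogeneous d p \<Longrightarrow> homogeneous d (- p :: 'a::comm_ring_1 mpoly)"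
  by (simp add: homogeneous_iff_grade grade.hom minus_monom)

lemma homogeneous_diff: "homogeneous d p \<Longrightarrow> homogeneous d q \<Longrightarrow> homogeneous d (p - q :: 'a::comm_ring_1 mpoly)"
  by (simp add: homogeneous_iff_grade grade.hom diff_monom)

lemma homogeneous_zero [simp]: "homogeneous d 0"
  by (simp add: homogeneous_def)

lemma homogeneous_mult: "homogeneous i p \<Longrightarrow> homogeneous j q \<Longrightarrow> homogeneous (i + j) (p * q :: 'a::comm_ring_1 mpoly)"
  by (simp add: homogeneous_iff_grade grade.hom mult_monom)

lemma homogeneous_const [simp]: "homogeneous 0 (const c)"
  by (auto simp: homogeneous_0_iff)

lemma homogeneous_const_mult: "homogeneous d p \<Longrightarrow> homogeneous d (const c * p :: 'a::comm_ring_1 mpoly)"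
  using homogeneous_mult[OF homogeneous_const] by fastforce

lemma homogeneous_sum: "(\<And>x. x \<in> S \<Longrightarrow> homogeneous d (g x)) \<Longrightarrow> homogeneous d (sum g S :: 'a::comm_ring_1 mpoly)"
  by (induction S rule: infinite_finite_induct) (auto intro: homogeneous_add)

lemma homogeneous_pvar [simp]: "homogeneous 1 (pvar i :: 'a::comm_ring_1 mpoly)"
  by (simp add: homogeneous_iff_grade grade_pvar)

lemma homogeneous_pvar_Suc [simp]: "homogeneous (Suc 0) (pvar i :: 'a::comm_ring_1 mpoly)"
  using homogeneous_pvar[of i] by simp

lemma homogeneous_power: "homogeneous d p \<Longrightarrow> homogeneous (d * k) (p ^ k :: 'a::comm_ring_1 mpoly)"
  by (simp add: homogeneous_iff_grade grade.hom monom_power)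

lemma homogeneous_mult_1_1: "homogeneous 1 p \<Longrightarrow> homogeneous 1 q \<Longrightarrow> homogeneous 2 (p * q :: 'a::comm_ring_1 mpoly)"
  using homogeneous_mult[of 1 p 1 q] by (simp add: numeral_2_eq_2)

lemmas homogeneous_intros = homogeneous_add homogeneous_diff homogeneous_uminus
  homogeneous_const_mult homogeneous_mult_1_1 homogeneous_pvar homogeneous_zero

lemma homogeneous_unique: "homogeneous i p \<Longrightarrow> homogeneous j (p :: 'a::comm_ring_1 mpoly) \<Longrightarrow> p \<noteq> 0 \<Longrightarrow> i = j"
  using tdeg_homogeneous by metis

lemma homogeneous_subst:
  fixes p :: "'a::comm_ring_1 mpoly"
  assumes "\<And>i. homogeneous 1 (v i)" "homogeneous d p"
  shows "homogeneous d (subst v p)"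
proof -
  have mon: "homogeneous (mdeg m) (mon v m)" for m
  proof -
    have "homogeneous (\<Sum>i\<in>S. lookup m i) (\<Prod>i\<in>S. v i ^ lookup m i)" for S
    proof (induction S rule: infinite_finite_induct)
      case (insert x F)
      then show ?case using homogeneous_power[OF assms(1)[of x], of "lookup m x"]
        by (auto intro: homogeneous_mult)
    qed (use homogeneous_const[of "1::'a"] in \<open>simp_all add: const.one\<close>)
    then show ?thesis by (simp add: mon_def mdeg_def)
  qed
  have "homogeneous d (const (lookup p m) * mon v m)" if "m \<in> keys p" for m
    using mon[of m] that assms(2) by (intro homogeneous_const_mult) (simp add: homogeneous_def)
  then show ?thesis
    unfolding subst_def mev_def by (rule homogeneous_sum)
qed

lemma homogeneous_dvd:
  fixes p q :: "'a::idom mpoly"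
  assumes "homogeneous d p" "p \<noteq> 0" "homogeneous (d + e) q" "p dvd q"
  obtains r where "homogeneous e r" "q = p * r"
proof (cases "q = 0")
  case True
  then show ?thesis using that[of 0] by simp
next
  case False
  obtain r where r: "q = p * r" using assms(4) by (rule dvdE)
  then obtain i j where "homogeneous i p" "homogeneous j r" "i + j = d + e"
    using homogeneous_factor[of "d + e" p r] assms(3) False by metis
  then show ?thesis using that r homogeneous_unique[OF assms(1) _ assms(2)] by auto
qed

lemma homogeneous_dvd_same:
  fixes p q :: "'a::idom mpoly"
  assumes "homogeneous d p" "p \<noteq> 0" "homogeneous d q" "p dvd q"
  obtains c where "q = const c * p"
proof -
  obtain r where "homogeneous 0 r" "q = p * r"
    using homogeneous_dvd[OF assms(1,2), of 0 q] assms(3,4) by auto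
  then show ?thesis using that by (auto simp: homogeneous_0_iff mult.commute)
qed

section \<open>Monomials of low degree and reduction modulo a linear form\<close>

lemma mdeg_add: "mdeg (m + n) = mdeg m + mdeg n"
proof -
  have sup: "mdeg m = (\<Sum>i\<in>S. lookup m i)" if "finite S" "keys m \<subseteq> S" for m S
    unfolding mdeg_def using that by (intro sum.mono_neutral_left) (auto simp: in_keys_iff)
  let ?S = "keys m \<union> keys n"
  have "keys (m + n) \<subseteq> ?S" by (rule Poly_Mapping.keys_add)
  then show ?thesis
    using sup[of ?S m] sup[of ?S n] sup[of ?S "m + n"] by (simp add: lookup_add sum.distrib)
qed

lemma mdeg_single [simp]: "mdeg (single i k) = k"
  by (cases "k = 0") (simp_all add: mdeg_def)

lemma mdeg_0_iff [simp]: "mdeg m = 0 \<longleftrightarrow> m = 0"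
proof
  assume "mdeg m = 0"
  then have "\<forall>i. lookup m i = 0" unfolding mdeg_def by (simp add: in_keys_iff)
  then show "m = 0" by (intro poly_mapping_eqI) simp
qed (simp add: mdeg_def)

lemma keys_decomp:
  assumes "i \<in> keys m"
  obtains m' where "m = single i (1::nat) + m'" "mdeg m = Suc (mdeg m')"
proof -
  have "m = single i 1 + (m - single i 1)"
    using assms by (intro poly_mapping_eqI) (auto simp: lookup_add lookup_minus lookup_single when_def in_keys_iff)
  then show ?thesis using that mdeg_add mdeg_single by (metis Suc_eq_plus1_left)
qed

lemma mdeg_1:
  assumes "mdeg m = 1" "i \<in> keys m"
  shows "m = single i 1"
  using assms by (elim keys_decomp) auto

lemma mdeg_2:
  assumes "mdeg m = 2"
  obtains i j where "m = single i 1 + single j 1"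
proof -
  have "m \<noteq> 0" using assms by (metis mdeg_0_iff zero_neq_numeral)
  then obtain i where "i \<in> keys m" by fastforce
  then obtain m' where m': "m = single i 1 + m'" "mdeg m = Suc (mdeg m')" by (rule keys_decomp)
  then have d: "mdeg m' = 1" using assms by simp
  then have "m' \<noteq> 0" by (metis mdeg_0_iff zero_neq_one)
  then obtain j where "j \<in> keys m'" by fastforce
  then show ?thesis using that m' mdeg_1[OF d] by blast
qed

text \<open>Solve \<open>l = 0\<close> for a variable \<open>j\<close> occurring in it. The
  substitution realises the quotient by \<open>l\<close> inside the same polynomial ring, where
  degrees and factoriality remain available.\<close>

lemma linear_retraction:
  fixes l :: "'k::field mpoly"
  assumes l: "homogeneous 1 l" "l \<noteq> 0"
  obtains v where "\<And>i. homogeneous 1 (v i)" "subst v l = 0" "\<And>p. l dvd p - subst v p"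
proof -
  obtain m where m: "m \<in> keys l" using l(2) by fastforce
  then have dm: "mdeg m = 1" using l(1) by (simp add: homogeneous_def)
  then have "m \<noteq> 0" by (metis mdeg_0_iff zero_neq_one)
  then obtain j where j: "j \<in> keys m" by fastforce
  have mj: "m = single j 1" using mdeg_1[OF dm j] .
  define c where "c = lookup l m"
  have c0: "c \<noteq> 0" using m by (simp add: c_def in_keys_iff)
  define l' where "l' = l - const c * pvar j"
  have cp: "const c * pvar j = single m c"
    by (simp add: const_def pvar_def mj mult_single)
  have ol: "over (- {j}) l'"
    unfolding over_def
  proof
    fix k assume k: "k \<in> keys l'"
    show "keys k \<subseteq> - {j}"
    proof (rule ccontr)
      assume "\<not> keys k \<subseteq> - {j}"
      then have jk: "j \<in> keys k" by blast
      have "homogeneous 1 l'" unfolding l'_def using l by (intro homogeneous_intros)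
      then have "k = m" using mdeg_1[OF _ jk] mj k by (simp add: homogeneous_def)
      moreover have "lookup l' m = 0" unfolding l'_def cp by (simp add: lookup_minus) (simp add: c_def)
      ultimately show False using k by (simp add: in_keys_iff)
    qed
  qed
  \<comment> \<open>With \<open>l = c * x_j + l'\<close> this sends \<open>x_j\<close> to
    \<open>- l' / c\<close>, which is free of \<open>x_j\<close>.\<close>
  define v where "v = pvar(j := pvar j - const (inverse c) * l)"
  have cc: "const c * (const (inverse c) * l) = l"
    using c0 by (simp add: mult.assoc[symmetric] const.mult[symmetric] const.one)
  have "subst v l' = l'" using ol by (rule subst_id_on) (auto simp: v_def)
  moreover have "l = const c * pvar j + l'" by (simp add: l'_def)
  ultimately have "subst v l = const c * v j + l'" by (metis subst.add subst.mult subst_const subst_pvar)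
  also have "\<dots> = const c * pvar j + l' - const c * (const (inverse c) * l)"
    by (simp add: v_def algebra_simps)
  also have "\<dots> = 0" unfolding cc by (simp add: l'_def)
  finally have z: "subst v l = 0" .
  have hv: "homogeneous 1 (v i)" for i
    using l by (auto simp: v_def intro!: homogeneous_intros)
  have dv: "l dvd p - subst v p" for p
    using over_UNIV[of p]
  proof (induction rule: over_induct)
    case (add p q)
    then have "l dvd (p - subst v p) + (q - subst v q)" by (rule dvd_add)
    then show ?case by (simp add: subst.hom algebra_simps)
  next
    case (mult p q)
    then have "l dvd p * (q - subst v q) + (p - subst v p) * subst v q" by (simp add: dvd_add)
    then show ?case by (simp add: subst.hom algebra_simps)
  qed (auto simp: v_def)
  show ?thesis by (rule that[OF hv z dv])
qed

lemma irreducible_quadric: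
  fixes f :: "'k::field mpoly"
  assumes f: "homogeneous 2 f" and no: "\<And>u v. homogeneous 1 u \<Longrightarrow> homogeneous 1 v \<Longrightarrow> f \<noteq> u * v"
  shows "irreducible f"
proof (rule irreducibleI)
  show f0: "f \<noteq> 0" using no[of 0 0] by simp
  show "\<not> f dvd 1" using f0 tdeg_homogeneous[OF f] by (simp add: unit_iff)
  fix a b assume e: "f = a * b"
  then obtain i j where h: "homogeneous i a" "homogeneous j b" "i + j = 2"
    using homogeneous_factor[of 2 a b] f f0 by metis
  have nz: "a \<noteq> 0" "b \<noteq> 0" using e f0 by auto
  have "\<not> (i = 1 \<and> j = 1)" using no[of a b] h e by auto
  then have "i = 0 \<or> j = 0" using h(3) by auto
  then show "a dvd 1 \<or> b dvd 1"
    using tdeg_homogeneous[OF h(1) nz(1)] tdeg_homogeneous[OF h(2) nz(2)] nz by (auto simp: unit_iff)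
qed

text \<open>Collective strength at least 2 for two quadrics, phrased by linear forms in all
  variables. Zero forms are allowed, so single products and linear dependence are excluded as
  well.\<close>

definition strong_pencil :: "'k::field mpoly \<Rightarrow> 'k mpoly \<Rightarrow> bool" where
  "strong_pencil f g \<longleftrightarrow> homogeneous 2 f \<and> homogeneous 2 g \<and>
    (\<forall>a b u v s t. (a \<noteq> 0 \<or> b \<noteq> 0) \<longrightarrow>
      homogeneous 1 u \<longrightarrow> homogeneous 1 v \<longrightarrow> homogeneous 1 s \<longrightarrow> homogeneous 1 t \<longrightarrow>
      const a * f + const b * g \<noteq> u * v + s * t)"

definition ideal2 :: "'a::comm_ring_1 \<Rightarrow> 'a \<Rightarrow> 'a set" where
  "ideal2 f g = {a * f + b * g | a b. True}"

lemma strong_pencilD: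
  assumes "strong_pencil f g" "a \<noteq> 0 \<or> b \<noteq> 0"
    "homogeneous 1 u" "homogeneous 1 v" "homogeneous 1 s" "homogeneous 1 t"
  shows "const a * f + const b * g \<noteq> u * v + s * t"
  using assms unfolding strong_pencil_def by blast

lemma strong_pencil_homogeneous: "strong_pencil f g \<Longrightarrow> homogeneous 2 f \<and> homogeneous 2 g"
  unfolding strong_pencil_def by blast

text \<open>A member of the pencil that became \<open>u * w\<close> modulo \<open>l\<close> would
  differ from \<open>u * w\<close> by \<open>l * m\<close>, with \<open>m\<close> linear by degree:
  two products in all.\<close>

lemma strong_pencil_retraction:
  fixes f g l :: "'k::field mpoly"
  assumes C: "strong_pencil f g" and ab: "a \<noteq> 0 \<or> b \<noteq> 0"
    and l: "homogeneous 1 l" "l \<noteq> 0"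
    and v: "\<And>i. homogeneous 1 (v i)" "\<And>p. l dvd p - subst v p"
    and uw: "homogeneous 1 u" "homogeneous 1 w"
  shows "subst v (const a * f + const b * g) \<noteq> u * w"
proof
  assume e: "subst v (const a * f + const b * g) = u * w"
  let ?h = "const a * f + const b * g"
  have h: "homogeneous 2 ?h"
    using strong_pencil_homogeneous[OF C] by (intro homogeneous_intros) auto
  have "homogeneous (1 + 1) (?h - subst v ?h)"
    using homogeneous_diff[OF h homogeneous_subst[of v, OF v(1) h]] by (simp add: numeral_2_eq_2)
  then obtain m where m: "homogeneous 1 m" "?h - subst v ?h = l * m"
    using homogeneous_dvd[OF l _ v(2)[of ?h]] by blast
  then have "?h = u * w + l * m" using e by (simp add: algebra_simps)
  then show False using strong_pencilD[OF C ab uw l(1) m(1)] by simp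
qed

text \<open>Modulo \<open>l\<close> the images of \<open>f\<close> and \<open>g\<close> are coprime,
  so every relation between them is a multiple of the trivial one. The relation given by
  \<open>l * p\<close> is therefore trivial up to multiples of \<open>l\<close>, and
  \<open>l\<close> cancels.\<close>

lemma strong_pencil_linear_regular:
  fixes f g l :: "'k::field mpoly"
  assumes C: "strong_pencil f g" and l: "homogeneous 1 l" "l \<noteq> 0" and lp: "l * p \<in> ideal2 f g"
  shows "p \<in> ideal2 f g"
proof -
  obtain v where v: "\<And>i. homogeneous 1 (v i)" "subst v l = 0" "\<And>p. l dvd p - subst v p"
    using linear_retraction[OF l] by blast
  let ?s = "subst v"
  have no: "?s (const a * f + const b * g) \<noteq> u * w"
    if "a \<noteq> 0 \<or> b \<noteq> 0" "homogeneous 1 u" "homogeneous 1 w" for a b u w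
    using strong_pencil_retraction[OF C that(1) l v(1,3) that(2,3)] .
  have hom: "homogeneous 2 (?s f)" "homogeneous 2 (?s g)"
    using strong_pencil_homogeneous[OF C] homogeneous_subst[OF v(1)] by auto
  have "irreducible (?s f)"
    using hom(1) no[of 1 0] by (intro irreducible_quadric) (auto simp: const.hom)
  then have pf: "prime_elem (?s f)" by (rule irreducible_imp_prime_elem_mpoly)
  then have f0: "?s f \<noteq> 0" by (rule prime_elem_not_zeroI)
  have nd: "\<not> ?s f dvd ?s g"
  proof
    assume "?s f dvd ?s g"
    then obtain c where "?s g = const c * ?s f" using homogeneous_dvd_same[OF hom(1) f0 hom(2)] by blast
    then show False using no[of "- c" 1 0 0] by (simp add: subst.hom const.hom)
  qed
  obtain a b where ab: "l * p = a * f + b * g" using lp unfolding ideal2_def by blast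
  have "?s (l * p) = ?s a * ?s f + ?s b * ?s g" unfolding ab by (simp add: subst.hom)
  then have e: "?s b * ?s g = - (?s a * ?s f)" using v(2) by (simp add: subst.hom eq_neg_iff_add_eq_0 add.commute)
  then have "?s f dvd ?s b * ?s g" by simp
  then have "?s f dvd ?s b" using pf nd prime_elem_dvd_mult_iff by blast
  \<comment> \<open>The reduced coefficients turn out to be \<open>t\<close> times the trivial
    relation \<open>(- ?s g, ?s f)\<close>.\<close>
  then obtain t where t: "?s b = ?s f * t" by (rule dvdE)
  then have "?s f * (?s a + t * ?s g) = 0" using e by (simp add: algebra_simps)
  then have sa: "?s a = - (t * ?s g)" using f0 by (simp add: eq_neg_iff_add_eq_0)
  obtain a1 where a1: "a - ?s a = l * a1" using v(3) by (rule dvdE)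
  obtain b1 where b1: "b - ?s b = l * b1" using v(3) by (rule dvdE)
  obtain f1 where f1: "f - ?s f = l * f1" using v(3) by (rule dvdE)
  obtain g1 where g1: "g - ?s g = l * g1" using v(3) by (rule dvdE)
  have gf: "?s g = g - l * g1" "?s f = f - l * f1"
    unfolding g1[symmetric] f1[symmetric] by simp_all
  have ea: "a = l * a1 - t * (g - l * g1)" unfolding gf[symmetric] using a1 sa by (simp add: algebra_simps)
  have eb: "b = l * b1 + t * (f - l * f1)" unfolding gf[symmetric] using b1 t by (simp add: algebra_simps)
  \<comment> \<open>The terms \<open>- t * g * f\<close> and \<open>t * f * g\<close> cancel;
    everything else carries a factor \<open>l\<close>.\<close>
  have "l * p = (l * a1 - t * (g - l * g1)) * f + (l * b1 + t * (f - l * f1)) * g"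
    using ab ea eb by simp
  also have "\<dots> = l * ((a1 + t * g1) * f + (b1 - t * f1) * g)"
    by (simp add: algebra_simps)
  finally have "l * p = l * ((a1 + t * g1) * f + (b1 - t * f1) * g)" .
  then have "p = (a1 + t * g1) * f + (b1 - t * f1) * g" using l(2) by (simp only: mult_cancel_left) blast
  then show ?thesis unfolding ideal2_def by blast
qed

section \<open>Elimination of a variable\<close>

lemma ideal2_add: "u \<in> ideal2 f g \<Longrightarrow> w \<in> ideal2 f g \<Longrightarrow> u + w \<in> ideal2 f (g :: 'a::comm_ring_1)"
  unfolding ideal2_def
proof clarsimp
  fix a b a' b'
  show "\<exists>c d. a * f + b * g + (a' * f + b' * g) = c * f + d * g"
    by (rule exI[of _ "a + a'"], rule exI[of _ "b + b'"]) (simp add: algebra_simps)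
qed

lemma ideal2_mult: "u \<in> ideal2 f g \<Longrightarrow> r * u \<in> ideal2 f (g :: 'a::comm_ring_1)"
  unfolding ideal2_def
proof clarsimp
  fix a b
  show "\<exists>c d. r * (a * f + b * g) = c * f + d * g"
    by (rule exI[of _ "r * a"], rule exI[of _ "r * b"]) (simp add: algebra_simps)
qed

lemma ideal2_gen: "f \<in> ideal2 f (g :: 'a::comm_ring_1)" "g \<in> ideal2 f g"
proof -
  have "f = 1 * f + 0 * g" "g = 0 * f + 1 * g" by simp_all
  then show "f \<in> ideal2 f g" "g \<in> ideal2 f g" unfolding ideal2_def by blast+
qed

lemma ideal2_diff: "u \<in> ideal2 f g \<Longrightarrow> w \<in> ideal2 f g \<Longrightarrow> u - w \<in> ideal2 f (g :: 'a::comm_ring_1)"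
  using ideal2_add[of u f g "- 1 * w"] ideal2_mult[of w f g "- 1"] by simp

lemma ideal2_dvd: "u \<in> ideal2 f g \<Longrightarrow> u dvd w \<Longrightarrow> w \<in> ideal2 f (g :: 'a::comm_ring_1)"
  by (auto elim!: dvdE simp: mult.commute intro: ideal2_mult)

lemma ideal2_commute: "ideal2 f g = ideal2 g (f :: 'a::comm_ring_1)"
proof -
  have "ideal2 f g \<subseteq> ideal2 g f" for f g :: 'a
  proof
    fix u assume "u \<in> ideal2 f g"
    then obtain a b where "u = a * f + b * g" unfolding ideal2_def by blast
    then have "u = b * g + a * f" by simp
    then show "u \<in> ideal2 g f" unfolding ideal2_def by blast
  qed
  then show ?thesis by blast
qed

definition prime_pair :: "'a::comm_ring_1 \<Rightarrow> 'a \<Rightarrow> bool" where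
  "prime_pair f g \<longleftrightarrow> (\<forall>u w. u * w \<in> ideal2 f g \<longrightarrow> u \<in> ideal2 f g \<or> w \<in> ideal2 f g)"

text \<open>Modulo \<open>pvar x * l + q\<close> one may replace \<open>pvar x * l\<close> by
  \<open>- q\<close>, so a large enough power of \<open>l\<close> clears every \<open>x\<close>.
  This is the localization at \<open>l\<close> without fractions.\<close>

lemma elimination:
  fixes l q p :: "'k::field mpoly"
  assumes "over (- {x}) l" "over (- {x}) q"
  shows "\<exists>N p0 e. over (- {x}) p0 \<and> l ^ N * p = p0 + e * (pvar x * l + q)"
  using over_UNIV[of p]
proof (induction rule: over_induct)
  case (const c)
  show ?case by (rule exI[of _ 0], rule exI[of _ "const c"], rule exI[of _ 0]) simp
next
  case (pvar i)
  show ?case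
  proof (cases "i = x")
    case True
    then show ?thesis using assms(2)
      by (intro exI[of _ 1] exI[of _ "- q"]) (auto intro: over_uminus)
  next
    case False
    then show ?thesis by (intro exI[of _ 0] exI[of _ "pvar i"]) auto
  qed
next
  case (add p p')
  then obtain N p0 e M p0' e' where h: "over (- {x}) p0" "l ^ N * p = p0 + e * (pvar x * l + q)"
    "over (- {x}) p0'" "l ^ M * p' = p0' + e' * (pvar x * l + q)" by blast
  have "l ^ (N + M) * (p + p') = l ^ M * (l ^ N * p) + l ^ N * (l ^ M * p')"
    by (simp add: power_add algebra_simps)
  also have "\<dots> = (l ^ M * p0 + l ^ N * p0') + (l ^ M * e + l ^ N * e') * (pvar x * l + q)"
    unfolding h by (simp add: algebra_simps)
  finally have "l ^ (N + M) * (p + p') = (l ^ M * p0 + l ^ N * p0') + (l ^ M * e + l ^ N * e') * (pvar x * l + q)" .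
  moreover have "over (- {x}) (l ^ M * p0 + l ^ N * p0')" using h(1,3) assms by (intro over_ring)
  ultimately show ?case by blast
next
  case (mult p p')
  then obtain N p0 e M p0' e' where h: "over (- {x}) p0" "l ^ N * p = p0 + e * (pvar x * l + q)"
    "over (- {x}) p0'" "l ^ M * p' = p0' + e' * (pvar x * l + q)" by blast
  let ?f = "pvar x * l + q"
  have "l ^ (N + M) * (p * p') = (l ^ N * p) * (l ^ M * p')"
    by (simp add: power_add algebra_simps)
  also have "\<dots> = p0 * p0' + (p0 * e' + e * p0' + e * e' * ?f) * ?f"
    unfolding h by (simp add: algebra_simps)
  finally have "l ^ (N + M) * (p * p') = p0 * p0' + (p0 * e' + e * p0' + e * e' * ?f) * ?f" .
  then show ?case using over_mult[OF h(1,3)] by blast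
qed

text \<open>Because \<open>l\<close> is nonzero, \<open>pvar x * l + q\<close> has degree 1 in
  \<open>x\<close>, and its nonzero multiples keep positive degree.\<close>

lemma free_multiple_eq_0:
  fixes l q p :: "'k::field mpoly"
  assumes "over (- {x}) l" "over (- {x}) q" "l \<noteq> 0"
    and "over (- {x}) (e * (pvar x * l + q))"
  shows "e * (pvar x * l + q) = 0"
proof (rule ccontr)
  assume nz: "e * (pvar x * l + q) \<noteq> 0"
  have xl: "xpoly x l = [:l:]" "xpoly x q = [:q:]"
    using xpoly_free assms by blast+
  have "xpoly x (pvar x * l + q) = [:q, l:]"
    by (simp add: xpoly.hom xl xpoly_pvar)
  moreover have "degree (xpoly x (e * (pvar x * l + q))) = 0"
    using xpoly_free[OF assms(4)] by simp
  moreover have "xpoly x e \<noteq> 0" using nz by auto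
  ultimately have "degree (xpoly x e) + degree [:q, l:] = 0"
    using assms(3) degree_mult_eq[of "xpoly x e" "[:q, l:]"] by (simp only: xpoly.mult) simp
  then show False using assms(3) by simp
qed

text \<open>After inverting \<open>l\<close>, solving \<open>f = 0\<close> for \<open>x\<close>
  leaves the other variables, where \<open>lg\<close> turns the ideal into the one generated by the
  prime \<open>c\<close>. That \<open>c\<close> does not divide \<open>l\<close> keeps this prime
  alive under localization, and \<open>reg\<close> carries primality back.\<close>

lemma prime_pair_elimination:
  fixes l q g c :: "'k::field mpoly"
  assumes free: "over (- {x}) l" "over (- {x}) q" "over (- {x}) c" and l0: "l \<noteq> 0"
    and f: "f = pvar x * l + q"
    and c: "prime_elem c" "c \<in> ideal2 f g" "\<not> c dvd l"
    and lg: "l * g = \<alpha> * f + \<beta> * c"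
    and reg: "\<And>p. l * p \<in> ideal2 f g \<Longrightarrow> p \<in> ideal2 f g"
  shows "prime_pair f g"
proof -
  note elim = elimination[OF free(1,2), folded f]
  have regp: "p \<in> ideal2 f g" if "l ^ N * p \<in> ideal2 f g" for N p
    using that by (induction N) (auto simp: mult.assoc intro: reg)
  have contract: "c dvd s" if s: "over (- {x}) s" "s \<in> ideal2 f g" for s
  proof -
    obtain a b where ab: "s = a * f + b * g" using s(2) unfolding ideal2_def by blast
    obtain N b0 e where e: "over (- {x}) b0" "l ^ N * (b * \<beta>) = b0 + e * f"
      using elim by blast
    have "l * s = (a * l) * f + b * (l * g)" unfolding ab by (simp add: algebra_simps)
    also have "\<dots> = (a * l + b * \<alpha>) * f + (b * \<beta>) * c" unfolding lg by (simp add: algebra_simps)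
    finally have ls: "l * s = (a * l + b * \<alpha>) * f + (b * \<beta>) * c" .
    have "l ^ N * (l * s) = l ^ N * (a * l + b * \<alpha>) * f + (l ^ N * (b * \<beta>)) * c"
      unfolding ls by (simp add: algebra_simps)
    also have "\<dots> = (l ^ N * (a * l + b * \<alpha>) + e * c) * f + b0 * c"
      unfolding e by (simp add: algebra_simps)
    finally have eq: "l ^ N * (l * s) - b0 * c = (l ^ N * (a * l + b * \<alpha>) + e * c) * f"
      by simp
    \<comment> \<open>This difference is free of \<open>x\<close> and yet a multiple of
      \<open>f\<close>, so it vanishes.\<close>
    have "over (- {x}) (l ^ N * (l * s) - b0 * c)"
      using free s e by (intro over_ring)
    then have "l ^ N * (l * s) - b0 * c = 0"
      using free_multiple_eq_0[OF free(1,2) l0] eq f by metis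
    then have "c dvd l ^ N * (l * s)" by (simp add: eq_iff_diff_eq_0[symmetric])
    then have "c dvd l ^ N \<or> c dvd l \<or> c dvd s" using c(1) by (simp add: prime_elem_dvd_mult_iff)
    then show ?thesis using c prime_elem_dvd_power by blast
  qed
  show ?thesis
    unfolding prime_pair_def
  proof (intro allI impI)
    fix u w assume uw: "u * w \<in> ideal2 f g"
    obtain N u0 e where u: "over (- {x}) u0" "l ^ N * u = u0 + e * f" using elim by blast
    obtain M w0 e' where w: "over (- {x}) w0" "l ^ M * w = w0 + e' * f" using elim by blast
    have e1: "u0 = l ^ N * u - e * f" "w0 = l ^ M * w - e' * f" using u w by simp_all
    \<comment> \<open>Both representatives are free of \<open>x\<close>, so membership of their
      product is decided by \<open>c\<close>.\<close>
    have "u0 * w0 = (l ^ N * l ^ M) * (u * w) - (l ^ N * u * e' + l ^ M * w * e - e * e' * f) * f"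
      unfolding e1 by (simp add: algebra_simps)
    then have "u0 * w0 \<in> ideal2 f g"
      using uw by (auto intro: ideal2_diff ideal2_mult ideal2_gen)
    then have "c dvd u0 * w0" using contract u(1) w(1) over_mult by blast
    then have "c dvd u0 \<or> c dvd w0" using c(1) by (simp add: prime_elem_dvd_mult_iff)
    then have "u0 \<in> ideal2 f g \<or> w0 \<in> ideal2 f g" using ideal2_dvd[OF c(2)] by blast
    then have "l ^ N * u \<in> ideal2 f g \<or> l ^ M * w \<in> ideal2 f g"
      unfolding u(2) w(2) by (auto intro: ideal2_add ideal2_mult ideal2_gen)
    then show "u \<in> ideal2 f g \<or> w \<in> ideal2 f g" using regp by blast
  qed
qed

section \<open>The cubic eliminant\<close>

lemma irreducible_linear:
  fixes l :: "'k::field mpoly"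
  assumes "homogeneous 1 l" "l \<noteq> 0"
  shows "irreducible l"
proof (rule irreducibleI)
  show "\<not> l dvd 1" using tdeg_homogeneous[OF assms] by (simp add: unit_iff)
  fix a b assume e: "l = a * b"
  then have nz: "a \<noteq> 0" "b \<noteq> 0" using assms by auto
  then have "tdeg a + tdeg b = 1" using tdeg_mult[of a b] e tdeg_homogeneous[OF assms] by simp
  then show "a dvd 1 \<or> b dvd 1" using nz by (auto simp: unit_iff)
qed (rule assms)

text \<open>The cubic is the resultant of the two quadrics in \<open>x\<close>. If it vanishes
  modulo \<open>m\<close>, the prime \<open>l1\<close> divides \<open>q1\<close>, making the first
  quadric a product, or divides \<open>l2\<close>, making the second a multiple of the first. If
  \<open>l1\<close> itself vanishes modulo \<open>m\<close>, then by \<open>ind\<close>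
  \<open>l2\<close> does not, so \<open>q1\<close> and the first quadric vanish.\<close>

lemma eliminant_no_linear_factor:
  fixes l1 l2 q1 q2 m :: "'k::field mpoly"
  assumes C: "strong_pencil (pvar x * l1 + q1) (pvar x * l2 + q2)"
    and hom: "homogeneous 1 l1" "homogeneous 1 l2" "homogeneous 2 q1" "homogeneous 2 q2"
    and ind: "\<And>a b. const a * l1 + const b * l2 = 0 \<Longrightarrow> a = 0 \<and> b = 0"
    and m: "homogeneous 1 m" "m \<noteq> 0"
  shows "\<not> m dvd l1 * q2 - l2 * q1"
proof
  assume dvd: "m dvd l1 * q2 - l2 * q1"
  let ?f = "pvar x * l1 + q1" and ?g = "pvar x * l2 + q2"
  obtain v where v: "\<And>i. homogeneous 1 (v i)" "subst v m = 0" "\<And>p. m dvd p - subst v p"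
    using linear_retraction[OF m] by blast
  let ?s = "subst v"
  have no: "?s (const a * ?f + const b * ?g) \<noteq> u * w"
    if "a \<noteq> 0 \<or> b \<noteq> 0" "homogeneous 1 u" "homogeneous 1 w" for a b u w
    using strong_pencil_retraction[OF C that(1) m v(1,3) that(2,3)] .
  have sf: "?s ?f = v x * ?s l1 + ?s q1" "?s ?g = v x * ?s l2 + ?s q2" by (simp_all add: subst.hom)
  have nof: "?s ?f \<noteq> u * w" if "homogeneous 1 u" "homogeneous 1 w" for u w
    using no[of 1 0 u w] that by (simp add: const.hom)
  have shom: "homogeneous 1 (?s l1)" "homogeneous 1 (?s l2)" "homogeneous 2 (?s q1)" "homogeneous 2 (?s q2)"
    using homogeneous_subst[of v, OF v(1)] hom by blast+
  have "?s m dvd ?s (l1 * q2 - l2 * q1)" using dvd by (rule subst.dvd)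
  then have eq: "?s l1 * ?s q2 = ?s l2 * ?s q1" using v(2) by (simp add: subst.hom)
  show False
  proof (cases "?s l1 = 0")
    case True
    have "?s l2 \<noteq> 0"
    proof
      assume "?s l2 = 0"
      then have "m dvd l1" "m dvd l2" using v(3)[of l1] v(3)[of l2] True by auto
      then obtain a b where ab: "l1 = const a * m" "l2 = const b * m"
        using homogeneous_dvd_same[OF m] hom by metis
      then have "const b * l1 + const (- a) * l2 = 0" by (simp add: const.hom)
      then have "a = 0" using ind by fastforce
      then have "const 1 * l1 + const 0 * l2 = 0" using ab by (simp add: const.hom)
      then show False using ind by fastforce
    qed
    then have "?s q1 = 0" using eq True by simp
    then have "?s ?f = 0 * 0" using True sf by simp
    then show False using nof[of 0 0] by simp
  next
    case False
    have "prime_elem (?s l1)"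
      using irreducible_imp_prime_elem_mpoly[OF irreducible_linear[OF shom(1) False]] .
    moreover have "?s l1 dvd ?s l2 * ?s q1" unfolding eq[symmetric] by simp
    ultimately consider "?s l1 dvd ?s q1" | "?s l1 dvd ?s l2" by (auto simp: prime_elem_dvd_mult_iff)
    then show False
    proof cases
      case 1
      have "homogeneous (1 + 1) (?s q1)" using shom(3) by (simp add: numeral_2_eq_2)
      then obtain t where t: "homogeneous 1 t" "?s q1 = ?s l1 * t"
        using homogeneous_dvd[OF shom(1) False _ 1] by blast
      then have "?s ?f = ?s l1 * (v x + t)" unfolding sf by (simp add: algebra_simps)
      then show False using nof[OF shom(1) homogeneous_add[OF v(1)[of x] t(1)]] by blast
    next
      case 2
      obtain c where c: "?s l2 = const c * ?s l1"
        using homogeneous_dvd_same[OF shom(1) False shom(2) 2] .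
      then have "?s l1 * ?s q2 = ?s l1 * (const c * ?s q1)" using eq by (simp add: algebra_simps)
      then have "?s q2 = const c * ?s q1" using False by simp
      then have "?s (const (- c) * ?f + const 1 * ?g) = 0 * 0"
        using c by (simp add: subst.hom const.hom algebra_simps)
      then show False using no[of "- c" 1 0 0] by simp
    qed
  qed
qed

text \<open>A proper factorization in degree 3 has a factor of degree 1.\<close>

lemma prime_elem_eliminant:
  fixes l1 l2 q1 q2 :: "'k::field mpoly"
  assumes C: "strong_pencil (pvar x * l1 + q1) (pvar x * l2 + q2)"
    and hom: "homogeneous 1 l1" "homogeneous 1 l2" "homogeneous 2 q1" "homogeneous 2 q2"
    and ind: "\<And>a b. const a * l1 + const b * l2 = 0 \<Longrightarrow> a = 0 \<and> b = 0"
  shows "prime_elem (l1 * q2 - l2 * q1)" "homogeneous 3 (l1 * q2 - l2 * q1)"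
proof -
  let ?c = "l1 * q2 - l2 * q1"
  have no: "\<not> m dvd ?c" if "homogeneous 1 m" "m \<noteq> 0" for m
    using eliminant_no_linear_factor[OF C hom ind that] by blast
  show h: "homogeneous 3 ?c"
    using homogeneous_diff[OF homogeneous_mult[OF hom(1,4)] homogeneous_mult[OF hom(2,3)]] by (simp add: numeral_3_eq_3)
  have l1: "l1 \<noteq> 0" using ind[of 1 0] by (auto simp: const.hom)
  have c0: "?c \<noteq> 0" using no[OF hom(1) l1] by auto
  have "irreducible ?c"
  proof (rule irreducibleI)
    show "\<not> ?c dvd 1" using tdeg_homogeneous[OF h c0] by (simp add: unit_iff)
    fix a b assume e: "?c = a * b"
    then obtain i j where ij: "homogeneous i a" "homogeneous j b" "i + j = 3"
      using homogeneous_factor[of 3 a b] h c0 by metis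
    have nz: "a \<noteq> 0" "b \<noteq> 0" using e c0 by auto
    have "i \<noteq> 1" "j \<noteq> 1" using no[of a] no[of b] nz ij e by auto
    then have "i = 0 \<or> j = 0" using ij(3) by auto
    then show "a dvd 1 \<or> b dvd 1"
      using tdeg_homogeneous[OF ij(1) nz(1)] tdeg_homogeneous[OF ij(2) nz(2)] nz by (auto simp: unit_iff)
  qed (rule c0)
  then show "prime_elem ?c" by (rule irreducible_imp_prime_elem_mpoly)
qed

lemma homogeneous_not_dvd:
  fixes p q :: "'k::field mpoly"
  assumes "homogeneous d p" "p \<noteq> 0" "homogeneous e q" "q \<noteq> 0" "e < d"
  shows "\<not> p dvd q"
proof
  assume "p dvd q"
  then obtain r where "q = p * r" by (rule dvdE)
  then have "tdeg q = tdeg p + tdeg r" using assms tdeg_mult[of p r] by auto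
  then show False using assms(5) tdeg_homogeneous[OF assms(1,2)] tdeg_homogeneous[OF assms(3,4)] by simp
qed

lemma prime_pair_decomposed:
  fixes l1 l2 q1 q2 :: "'k::field mpoly"
  assumes C: "strong_pencil (pvar x * l1 + q1) (pvar x * l2 + q2)"
    and hom: "homogeneous 1 l1" "homogeneous 1 l2" "homogeneous 2 q1" "homogeneous 2 q2"
    and free: "over (- {x}) l1" "over (- {x}) l2" "over (- {x}) q1" "over (- {x}) q2"
    and l1: "l1 \<noteq> 0"
  shows "prime_pair (pvar x * l1 + q1) (pvar x * l2 + q2)"
proof -
  let ?f = "pvar x * l1 + q1" and ?g = "pvar x * l2 + q2"
  note reg = strong_pencil_linear_regular[OF C hom(1) l1]
  show ?thesis
  proof (cases "\<exists>c. l2 = const c * l1")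
    case True
    then obtain c where c: "l2 = const c * l1" by blast
    \<comment> \<open>The terms in \<open>x\<close> cancel in this member of the pencil, which takes
      the place of the cubic.\<close>
    define d where "d = q2 - const c * q1"
    have dfg: "d = ?g - const c * ?f" unfolding d_def c by (simp add: algebra_simps)
    have hd: "homogeneous 2 d" unfolding d_def using hom by (intro homogeneous_intros)
    have "d \<noteq> u * w" if "homogeneous 1 u" "homogeneous 1 w" for u w
      using strong_pencilD[OF C, of "- c" 1 u w 0 0] that by (simp add: dfg const.hom)
    then have "irreducible d" by (rule irreducible_quadric[OF hd])
    then have pd: "prime_elem d" by (rule irreducible_imp_prime_elem_mpoly)
    show ?thesis
    proof (rule prime_pair_elimination[OF free(1,3) _ l1 refl pd])
      show "over (- {x}) d" unfolding d_def using free by (intro over_ring over_const)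
      show "d \<in> ideal2 ?f ?g" unfolding dfg by (intro ideal2_diff ideal2_mult ideal2_gen)
      show "\<not> d dvd l1" using homogeneous_not_dvd[OF hd _ hom(1) l1] pd by auto
      show "l1 * ?g = (const c * l1) * ?f + l1 * d" unfolding dfg by (simp add: algebra_simps)
    qed (rule reg)
  next
    case False
    have ind: "a = 0 \<and> b = 0" if e: "const a * l1 + const b * l2 = 0" for a b
    proof -
      have "b = 0"
      proof (rule ccontr)
        assume b: "b \<noteq> 0"
        have "l2 = const (inverse b) * (const b * l2)"
          using b by (simp add: mult.assoc[symmetric] const.mult[symmetric] const.one)
        also have "const b * l2 = - (const a * l1)"
          using e by (simp add: eq_neg_iff_add_eq_0 add.commute)
        also have "const (inverse b) * - (const a * l1) = const (- (inverse b * a)) * l1"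
          by (simp add: const.hom)
        finally show False using False by blast
      qed
      then show ?thesis using e l1 by (simp add: const.zero)
    qed
    let ?c = "l1 * q2 - l2 * q1"
    have pc: "prime_elem ?c" "homogeneous 3 ?c"
      using prime_elem_eliminant[OF C hom] ind by blast+
    show ?thesis
    proof (rule prime_pair_elimination[OF free(1,3) _ l1 refl pc(1)])
      show "over (- {x}) ?c" using free by (intro over_ring)
      have "?c = l1 * ?g - l2 * ?f" by (simp add: algebra_simps)
      then show "?c \<in> ideal2 ?f ?g" by (simp only:) (intro ideal2_diff ideal2_mult ideal2_gen)
      show "\<not> ?c dvd l1" using homogeneous_not_dvd[OF pc(2) prime_elem_not_zeroI[OF pc(1)] hom(1) l1] by simp
      show "l1 * ?g = l2 * ?f + 1 * ?c" by (simp add: algebra_simps)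
    qed (rule reg)
  qed
qed

section \<open>Common zeros and linear changes of coordinates\<close>

definition eval :: "(nat \<Rightarrow> 'a) \<Rightarrow> 'a::comm_ring_1 mpoly \<Rightarrow> 'a" where
  "eval = mev (\<lambda>x. x)"

interpretation eval: rhom "eval v" for v :: "nat \<Rightarrow> 'a::comm_ring_1"
  unfolding eval_def by (rule rhom_mev[OF rhom_id])

lemma eval_pvar [simp]: "eval v (pvar i) = v i"
  by (simp add: eval_def mev_pvar rhom_id)

lemma eval_const [simp]: "eval v (const c) = c"
  by (simp add: eval_def mev_const rhom_id)

lemma eval_alt: "eval u p = (\<Sum>m\<in>keys p. lookup p m * mon u m)"
  by (simp add: eval_def mev_def)

lemma eval_subst: "eval u (subst v p) = eval (\<lambda>i. eval u (v i)) p"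
  by (rule rhom_eqI[OF rhom_comp[OF eval.rhom_axioms subst.rhom_axioms] eval.rhom_axioms over_UNIV])
    simp_all

definition unit_vec :: "nat \<Rightarrow> nat \<Rightarrow> 'a::zero_neq_one" where
  "unit_vec a i = (if i = a then 1 else 0)"

text \<open>\<open>B\<close> is the cross term in the expansion of \<open>f\<close> on a plane.
  Linearity in the second argument lets the kernel of \<open>B e\<close> be computed on coordinate
  vectors.\<close>

definition polar_form :: "'k::field mpoly \<Rightarrow> ((nat \<Rightarrow> 'k) \<Rightarrow> (nat \<Rightarrow> 'k) \<Rightarrow> 'k) \<Rightarrow> bool" where
  "polar_form f B \<longleftrightarrow>
    (\<forall>s t u v. eval (\<lambda>i. s * u i + t * v i) f = s\<^sup>2 * eval u f + s * t * B u v + t\<^sup>2 * eval v f) \<and>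
    (\<forall>s t u v w. B u (\<lambda>i. s * v i + t * w i) = s * B u v + t * B u w)"

lemma polar_formD:
  assumes "polar_form f B"
  shows "eval (\<lambda>i. s * u i + t * v i) f = s\<^sup>2 * eval u f + s * t * B u v + t\<^sup>2 * eval v f"
    and "B u (\<lambda>i. s * v i + t * w i) = s * B u v + t * B u w"
  using assms unfolding polar_form_def by blast+

text \<open>Each monomial is a product of variables \<open>I m\<close> and \<open>J m\<close>,
  possibly equal; expanding the product of two binomials yields \<open>B\<close>.\<close>

lemma quadratic_map:
  fixes f :: "'k::field mpoly"
  assumes "homogeneous 2 f"
  obtains B where "polar_form f B"
proof -
  have "\<exists>i j. m = single i 1 + single j 1" if "m \<in> keys f" for m
    using assms that mdeg_2[of m] by (metis homogeneous_def)
  then obtain I J where IJ: "\<And>m. m \<in> keys f \<Longrightarrow> m = single (I m) 1 + single (J m) 1" by metis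
  have ev: "eval u f = (\<Sum>m\<in>keys f. lookup f m * (u (I m) * u (J m)))" for u
    unfolding eval_alt
  proof (rule sum.cong[OF refl])
    fix m assume "m \<in> keys f"
    then have "mon u m = mon u (single (I m) 1 + single (J m) 1)" using IJ by metis
    then show "lookup f m * mon u m = lookup f m * (u (I m) * u (J m))" by (simp add: mon_add)
  qed
  define B where "B u v = (\<Sum>m\<in>keys f. lookup f m * (u (I m) * v (J m) + v (I m) * u (J m)))" for u v
  have "polar_form f B"
    unfolding polar_form_def
  proof (intro conjI allI)
    fix s t u v
    show "eval (\<lambda>i. s * u i + t * v i) f = s\<^sup>2 * eval u f + s * t * B u v + t\<^sup>2 * eval v f"
      unfolding ev B_def sum_distrib_left sum.distrib[symmetric]
      by (rule sum.cong[OF refl]) (simp add: algebra_simps power2_eq_square)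
  next
    fix s t u v w
    show "B u (\<lambda>i. s * v i + t * w i) = s * B u v + t * B u w"
      unfolding B_def sum_distrib_left sum.distrib[symmetric]
      by (rule sum.cong[OF refl]) (simp add: algebra_simps)
  qed
  then show ?thesis by (rule that)
qed

text \<open>Here algebraic closure enters: set \<open>t = 1\<close> and take a root in
  \<open>s\<close>, unless \<open>A = 0\<close> makes \<open>(1, 0)\<close> a zero.\<close>

lemma binary_quadratic_zero:
  fixes A B C :: "'k::field"
  assumes "alg_closed TYPE('k)"
  obtains s t where "s \<noteq> 0 \<or> t \<noteq> 0" "s\<^sup>2 * A + s * t * B + t\<^sup>2 * C = 0"
proof (cases "A = 0")
  case True
  then show ?thesis using that[of 1 0] by simp
next
  case False
  then have "degree [:C, B, A:] > 0" by simp
  then obtain s where "poly [:C, B, A:] s = 0" using assms unfolding alg_closed_def by blast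
  then show ?thesis using that[of s 1] by (simp add: algebra_simps power2_eq_square)
qed

text \<open>
  The linear form \<open>B e\<close> has a two-dimensional kernel on the span of the coordinate vectors \<open>b, c, d\<close>,
  and \<open>f\<close> has a zero \<open>w\<close> in it. Then \<open>f\<close> vanishes on the whole span of \<open>e\<close> and \<open>w\<close>, and \<open>g\<close> has a
  zero there.
\<close>

lemma common_zero_extend:
  fixes f g :: "'k::field mpoly"
  assumes k: "alg_closed TYPE('k)" and f: "homogeneous 2 f" and g: "homogeneous 2 g"
    and e: "eval e f = 0" "e a \<noteq> 0" "\<And>i. i \<notin> S \<Longrightarrow> e i = 0"
    and bcd: "distinct [a, b, c, d]" "{b, c, d} \<subseteq> S"
  obtains p where "eval p f = 0" "eval p g = 0" "p \<noteq> (\<lambda>_. 0)" "\<And>i. i \<notin> S \<Longrightarrow> p i = 0"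
proof -
  note ret = that
  obtain B where pB: "polar_form f B" by (rule quadratic_map[OF f])
  note B = polar_formD[OF pB]
  obtain B' where pB': "polar_form g B'" by (rule quadratic_map[OF g])
  note B' = polar_formD[OF pB']
  \<comment> \<open>The conditions \<open>w a = 0\<close> and \<open>e a \<noteq> 0\<close> make
    \<open>e\<close> and \<open>w\<close> independent.\<close>
  have fin: thesis
    if w: "B e w = 0" "eval w f = 0" "w a = 0" "w \<noteq> (\<lambda>_. 0)" "\<And>i. i \<notin> S \<Longrightarrow> w i = 0" for w
  proof -
    obtain s t where st: "s \<noteq> 0 \<or> t \<noteq> 0" "s\<^sup>2 * eval e g + s * t * B' e w + t\<^sup>2 * eval w g = 0"
      using binary_quadratic_zero[OF k] .
    show thesis
    proof (rule ret)
      show "eval (\<lambda>i. s * e i + t * w i) f = 0" unfolding B using e w by simp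
      show "eval (\<lambda>i. s * e i + t * w i) g = 0" unfolding B' using st by simp
      show "(\<lambda>i. s * e i + t * w i) \<noteq> (\<lambda>_. 0)"
      proof
        assume z: "(\<lambda>i. s * e i + t * w i) = (\<lambda>_. 0)"
        then have "s * e a + t * w a = 0" by metis
        then have s: "s = 0" using w e by simp
        obtain i where "w i \<noteq> 0" using w(4) by blast
        then show False using st(1) s fun_cong[OF z, of i] by simp
      qed
      show "s * e i + t * w i = 0" if "i \<notin> S" for i using that e w by simp
    qed
  qed
  have kern: thesis
    if u: "B e u = 0" "u a = 0" "\<And>i. i \<notin> S \<Longrightarrow> u i = 0"
      and v: "B e v = 0" "v a = 0" "\<And>i. i \<notin> S \<Longrightarrow> v i = 0"
      and xy: "u x \<noteq> 0" "v x = 0" "u y = 0" "v y \<noteq> 0" for u v x y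
  proof -
    obtain s t where st: "s \<noteq> 0 \<or> t \<noteq> 0" "s\<^sup>2 * eval u f + s * t * B u v + t\<^sup>2 * eval v f = 0"
      using binary_quadratic_zero[OF k] .
    let ?w = "\<lambda>i. s * u i + t * v i"
    have nz: "?w \<noteq> (\<lambda>_. 0)"
    proof
      assume z: "?w = (\<lambda>_. 0)"
      then show False using st(1) fun_cong[OF z, of x] fun_cong[OF z, of y] xy by auto
    qed
    show thesis
      by (rule fin[of ?w]) (use u v st nz in \<open>simp_all add: B\<close>)
  qed
  let ?l = "\<lambda>i. B e (unit_vec i)"
  \<comment> \<open>If \<open>?l z\<close> is nonzero, the kernel of \<open>?l\<close> on the three
    coordinates is spanned by the vectors \<open>?l z * x - ?l x * z\<close> and
    \<open>?l z * y - ?l y * z\<close>.\<close>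
  have gen: thesis if z: "?l z \<noteq> 0" and xyz: "distinct [a, x, y, z]" "{x, y, z} \<subseteq> S" for x y z
  proof (rule kern[where x = x and y = y])
    show "B e (\<lambda>i. ?l z * unit_vec x i + (- ?l x) * unit_vec z i) = 0" unfolding B by simp
    show "B e (\<lambda>i. ?l z * unit_vec y i + (- ?l y) * unit_vec z i) = 0" unfolding B by simp
  qed (use z xyz in \<open>auto simp: unit_vec_def\<close>)
  consider "?l c \<noteq> 0" | "?l b \<noteq> 0" | "?l b = 0" "?l c = 0" by blast
  then show thesis
  proof cases
    case 1
    then show thesis using gen[of c b d] bcd by auto
  next
    case 2
    then show thesis using gen[of b c d] bcd by auto
  next
    case 3
    show thesis
      by (rule kern[where x = b and y = c, OF 3(1) _ _ 3(2)]) (use bcd in \<open>auto simp: unit_vec_def\<close>)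
  qed
qed

lemma isotropic_vector:
  fixes f :: "'k::field mpoly"
  assumes k: "alg_closed TYPE('k)" and f: "homogeneous 2 f" and ab: "a \<noteq> b"
  obtains e where "eval e f = 0" "e a \<noteq> 0 \<or> e b \<noteq> 0" "\<And>i. i \<notin> {a, b} \<Longrightarrow> e i = 0"
proof -
  obtain B where pB: "polar_form f B" by (rule quadratic_map[OF f])
  note B = polar_formD[OF pB]
  obtain s t where st: "s \<noteq> 0 \<or> t \<noteq> 0"
    "s\<^sup>2 * eval (unit_vec a) f + s * t * B (unit_vec a) (unit_vec b) + t\<^sup>2 * eval (unit_vec b) f = 0"
    using binary_quadratic_zero[OF k] .
  show thesis
  proof (rule that[of "\<lambda>i. s * unit_vec a i + t * unit_vec b i"])
    show "eval (\<lambda>i. s * unit_vec a i + t * unit_vec b i) f = 0" unfolding B by (rule st(2))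
  qed (use ab st(1) in \<open>auto simp: unit_vec_def\<close>)
qed

text \<open>Already the span of the first two coordinate vectors contains a zero of
  \<open>f\<close>; whichever of its two coordinates is nonzero plays the part of \<open>a\<close>
  in the extension.\<close>

lemma common_zero:
  fixes f g :: "'k::field mpoly"
  assumes k: "alg_closed TYPE('k)" and f: "homogeneous 2 f" and g: "homogeneous 2 g"
    and abcd: "distinct [a, b, c, d]" "{a, b, c, d} \<subseteq> S"
  obtains p where "eval p f = 0" "eval p g = 0" "p \<noteq> (\<lambda>_. 0)" "\<And>i. i \<notin> S \<Longrightarrow> p i = 0"
proof -
  have "a \<noteq> b" using abcd by simp
  then obtain e where e: "eval e f = 0" "e a \<noteq> 0 \<or> e b \<noteq> 0" "\<And>i. i \<notin> {a, b} \<Longrightarrow> e i = 0"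
    using isotropic_vector[OF k f] by blast
  have S: "\<And>i. i \<notin> S \<Longrightarrow> e i = 0" using e(3) abcd(2) by blast
  from e(2) show thesis
  proof
    assume nz: "e a \<noteq> 0"
    show thesis
    proof (rule common_zero_extend[OF k f g e(1) nz S, where b = b and c = c and d = d])
      show "distinct [a, b, c, d]" "{b, c, d} \<subseteq> S" using abcd by auto
    qed (blast intro: that)+
  next
    assume nz: "e b \<noteq> 0"
    show thesis
    proof (rule common_zero_extend[OF k f g e(1) nz S, where b = a and c = c and d = d])
      show "distinct [b, a, c, d]" "{a, c, d} \<subseteq> S" using abcd by auto
    qed (blast intro: that)+
  qed
qed

section \<open>Coordinate changes and the shape of a quadric at a zero\<close>

definition linear_automorphism :: "(nat \<Rightarrow> 'a::comm_ring_1 mpoly) \<Rightarrow> (nat \<Rightarrow> 'a mpoly) \<Rightarrow> bool" where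
  "linear_automorphism v v' \<longleftrightarrow> (\<forall>i. homogeneous 1 (v i) \<and> homogeneous 1 (v' i)) \<and>
    (\<forall>h. subst v' (subst v h) = h)"

lemma linear_automorphismD:
  assumes "linear_automorphism v v'"
  shows "homogeneous 1 (v i)" "homogeneous 1 (v' i)" "subst v' (subst v h) = h"
  using assms unfolding linear_automorphism_def by blast+

text \<open>The automorphism \<open>v\<close> moves the point \<open>p\<close> to the coordinate point \<open>unit_vec a\<close>, up to scaling.\<close>

lemma coordinate_change:
  fixes p :: "nat \<Rightarrow> 'k::field"
  assumes p: "p a \<noteq> 0" "\<And>i. i \<notin> V \<Longrightarrow> p i = 0"
  obtains v v' where "linear_automorphism v v'"
    "\<forall>h. over V h \<longrightarrow> over V (subst v h)"
    "\<forall>h. homogeneous 2 h \<longrightarrow> eval p h = 0 \<longrightarrow> eval (unit_vec a) (subst v h) = 0"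
proof -
  \<comment> \<open>A shear: for \<open>s = 1\<close> the new coordinates take the values
    \<open>p i / p a\<close> at \<open>unit_vec a\<close>, and changing the sign of \<open>s\<close>
    inverts it.\<close>
  define w where "w s i = (if i = a then pvar a else pvar i + const (s * (p i / p a)) * pvar a)" for s i
  have hw: "homogeneous 1 (w s i)" for s i
    unfolding w_def by (auto intro!: homogeneous_intros simp del: One_nat_def)
  have inv: "subst (w s) (subst (w (- s)) h) = h" for s h
    by (rule rhom_eqI[OF rhom_comp[OF subst.rhom_axioms subst.rhom_axioms] rhom_id over_UNIV])
      (auto simp: w_def subst.hom const.hom)
  have aV: "a \<in> V" using p by blast
  have ov: "over V (subst (w 1) h)" if "over V h" for h
    using that aV by (intro over_subst) (auto simp: w_def intro!: over_ring)
  have ev: "eval (unit_vec a) (subst (w 1) h) = 0" if h: "homogeneous 2 h" "eval p h = 0" for h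
  proof -
    obtain B where pB: "polar_form h B" by (rule quadratic_map[OF h(1)])
    \<comment> \<open>The zero second summand lets \<open>polar_formD\<close> express how
      \<open>h\<close> scales.\<close>
    have "(\<lambda>i. eval (unit_vec a) (w 1 i)) = (\<lambda>i. inverse (p a) * p i + 0 * p i)"
      using p(1) by (auto simp: w_def unit_vec_def eval.hom fun_eq_iff field_simps)
    then have "eval (unit_vec a) (subst (w 1) h) = eval (\<lambda>i. inverse (p a) * p i + 0 * p i) h"
      by (simp add: eval_subst)
    also have "\<dots> = 0" unfolding polar_formD(1)[OF pB] h(2) by simp
    finally show ?thesis .
  qed
  show thesis
    using ov ev hw inv[of "- 1"] by (intro that[of "w 1" "w (- 1)"]) (auto simp: linear_automorphism_def)
qed

text \<open>At \<open>unit_vec a\<close> only the square of \<open>pvar a\<close> survives, so its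
  coefficient is the value of \<open>h\<close>, which is 0. Every monomial then has a factor other
  than \<open>pvar a\<close>, named \<open>i\<close> after a swap if necessary.\<close>

lemma quadric_no_square:
  fixes h :: "'k::field mpoly"
  assumes h: "homogeneous 2 h" "over V h" "eval (unit_vec a) h = 0" and m: "m \<in> keys h"
  obtains i j where "m = single i 1 + single j 1" "i \<noteq> a" "i \<in> V" "j \<in> V"
proof -
  have dm: "mdeg m = 2" using h(1) m by (simp add: homogeneous_def)
  obtain i j where ij: "m = single i 1 + single j 1" by (rule mdeg_2[OF dm])
  have mono: "mon (unit_vec a) m' = (if m' = single a 2 then 1 else 0 :: 'k)" if "m' \<in> keys h" for m'
  proof -
    have "mdeg m' = 2" using h(1) that by (simp add: homogeneous_def)
    then obtain i j where ij: "m' = single i 1 + single j 1" by (rule mdeg_2)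
    have "single a 2 = single a 1 + single a (1::nat)" by (simp add: single_add[symmetric] numeral_2_eq_2)
    then have "m' = single a 2 \<longleftrightarrow> i = a \<and> j = a"
      unfolding ij
      by (auto simp: poly_mapping_eq_iff fun_eq_iff lookup_add lookup_single when_def split: if_splits)
    then show ?thesis unfolding ij by (auto simp: mon_add unit_vec_def)
  qed
  have "eval (unit_vec a) h = (\<Sum>m'\<in>keys h. if m' = single a 2 then lookup h m' else 0)"
    unfolding eval_alt by (rule sum.cong[OF refl]) (simp add: mono)
  also have "\<dots> = lookup h (single a 2)" by (simp add: in_keys_iff)
  finally have "lookup h (single a 2) = 0" using h(3) by simp
  then have "m \<noteq> single a 2" using m by (auto simp: in_keys_iff)
  then have "\<not> (i = a \<and> j = a)" unfolding ij by (auto simp: single_add[symmetric] numeral_2_eq_2)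
  moreover have "keys m \<subseteq> V" using h(2) m by (simp add: over_def)
  then have "i \<in> V" "j \<in> V" unfolding ij by (auto simp: in_keys_iff lookup_add lookup_single subset_iff)
  moreover have "m = single j 1 + single i 1" using ij by (simp add: add.commute)
  ultimately show thesis using that ij by blast
qed


lemma single_quadratic: "single (single i 1 + single j 1) c = const c * (pvar i * pvar j :: 'k::field mpoly)"
  by (simp add: const_def pvar_def mult_single)

lemma mpoly_closure:
  fixes h :: "'a::comm_ring_1 mpoly"
  assumes "P 0" "\<And>p q. P p \<Longrightarrow> P q \<Longrightarrow> P (p + q)"
    and "\<And>m. m \<in> keys h \<Longrightarrow> P (single m (lookup h m))"
  shows "P h"
proof -
  have "P (\<Sum>m\<in>S. single m (lookup h m))" if "S \<subseteq> keys h" for S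
    using that by (induction S rule: infinite_finite_induct) (use assms in auto)
  then show ?thesis using mpoly_sum_single[of h] by (metis order_refl)
qed

text \<open>No monomial contains \<open>pvar a\<close> twice, so each contributes to
  \<open>l\<close> or to \<open>q\<close>.\<close>

lemma quadric_decompose:
  fixes h :: "'k::field mpoly"
  assumes h: "homogeneous 2 h" "over V h" "eval (unit_vec a) h = 0"
  obtains l q where "h = pvar a * l + q" "homogeneous 1 l" "homogeneous 2 q"
    "over (V - {a}) l" "over (V - {a}) q"
proof -
  define P where "P = (\<lambda>p. \<exists>l q. p = pvar a * l + q \<and> homogeneous 1 l \<and> homogeneous 2 q \<and>
    over (V - {a}) l \<and> over (V - {a}) (q :: 'k mpoly))"
  have "P h"
  proof (rule mpoly_closure)
    show "P 0" unfolding P_def by (rule exI[of _ 0], rule exI[of _ 0]) simp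
  next
    fix p p' assume "P p" "P p'"
    then obtain l q l' q' where e: "p = pvar a * l + q" "homogeneous 1 l" "homogeneous 2 q"
      "over (V - {a}) l" "over (V - {a}) q"
      "p' = pvar a * l' + q'" "homogeneous 1 l'" "homogeneous 2 q'"
      "over (V - {a}) l'" "over (V - {a}) q'"
      unfolding P_def by blast
    have "p + p' = pvar a * (l + l') + (q + q')" unfolding e by (simp add: algebra_simps)
    moreover have "homogeneous 1 (l + l')" "homogeneous 2 (q + q')"
      using e by (auto intro: homogeneous_add)
    moreover have "over (V - {a}) (l + l')" "over (V - {a}) (q + q')" using e by (auto intro: over_add)
    ultimately show "P (p + p')" unfolding P_def by blast
  next
    fix m assume "m \<in> keys h"
    then obtain i j where ij: "m = single i 1 + single j 1" "i \<noteq> a" "i \<in> V" "j \<in> V"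
      by (rule quadric_no_square[OF h])
    define c where "c = lookup h m"
    have s: "single m c = const c * (pvar i * pvar j)" unfolding ij(1) by (rule single_quadratic)
    have hp: "homogeneous 1 (const c * pvar i)" by (intro homogeneous_intros)
    have op: "over (V - {a}) (const c * pvar i)" using ij by (intro over_mult) auto
    show "P (single m (lookup h m))"
    proof (cases "j = a")
      case True
      have "single m c = pvar a * (const c * pvar i) + 0" unfolding s True by (simp add: algebra_simps)
      then show ?thesis unfolding P_def c_def[symmetric] using hp op homogeneous_zero over_zero by blast
    next
      case False
      have "single m c = pvar a * 0 + const c * (pvar i * pvar j)" unfolding s by simp
      moreover have "homogeneous 2 (const c * (pvar i * pvar j))" by (intro homogeneous_intros)
      moreover have "over (V - {a}) (const c * (pvar i * pvar j))" using ij False by (intro over_mult) auto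
      ultimately show ?thesis unfolding P_def c_def[symmetric] using homogeneous_zero over_zero by blast
    qed
  qed
  then show thesis using that unfolding P_def by blast
qed

text \<open>With the square of \<open>pvar a\<close> missing, every remaining monomial contains
  \<open>pvar b\<close> or \<open>pvar c\<close>.\<close>

lemma ternary_quadric:
  fixes h :: "'k::field mpoly"
  assumes h: "homogeneous 2 h" "over {a, b, c} h" "eval (unit_vec a) h = 0"
  obtains u v where "h = pvar b * u + pvar c * v" "homogeneous 1 u" "homogeneous 1 v"
proof -
  define P where "P = (\<lambda>p. \<exists>u v. p = pvar b * u + pvar c * v \<and> homogeneous 1 u \<and> homogeneous 1 (v :: 'k mpoly))"
  have "P h"
  proof (rule mpoly_closure)
    show "P 0" unfolding P_def by (rule exI[of _ 0], rule exI[of _ 0]) simp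
  next
    fix p p' assume "P p" "P p'"
    then obtain u v u' v' where e: "p = pvar b * u + pvar c * v" "homogeneous 1 u" "homogeneous 1 v"
      "p' = pvar b * u' + pvar c * v'" "homogeneous 1 u'" "homogeneous 1 v'"
      unfolding P_def by blast
    have "p + p' = pvar b * (u + u') + pvar c * (v + v')" unfolding e by (simp add: algebra_simps)
    moreover have "homogeneous 1 (u + u')" "homogeneous 1 (v + v')"
      using e by (auto intro: homogeneous_add)
    ultimately show "P (p + p')" unfolding P_def by blast
  next
    fix m assume "m \<in> keys h"
    then obtain i j where ij: "m = single i 1 + single j 1" "i \<noteq> a" "i \<in> {a, b, c}" "j \<in> {a, b, c}"
      by (rule quadric_no_square[OF h])
    define d where "d = lookup h m"
    have s: "single m d = const d * (pvar i * pvar j)" unfolding ij(1) by (rule single_quadratic)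
    have hp: "homogeneous 1 (const d * pvar j)" by (intro homogeneous_intros)
    have "i = b \<or> i = c" using ij by blast
    then have "single m d = pvar b * (const d * pvar j) + pvar c * 0 \<or>
      single m d = pvar b * 0 + pvar c * (const d * pvar j)"
      unfolding s by (auto simp: algebra_simps)
    then show "P (single m (lookup h m))"
      unfolding P_def d_def[symmetric] using hp homogeneous_zero by blast
  qed
  then show thesis using that unfolding P_def by blast
qed

section \<open>Strong pencils generate prime ideals\<close>

lemma strong_pencil_subst:
  assumes C: "strong_pencil f g" and v: "linear_automorphism v v'"
  shows "strong_pencil (subst v f) (subst v g)"
  unfolding strong_pencil_def
proof (intro conjI allI impI notI)
  show "homogeneous 2 (subst v f)" "homogeneous 2 (subst v g)"
    using strong_pencil_homogeneous[OF C] homogeneous_subst[of v, OF linear_automorphismD(1)[OF v]] by auto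
  fix a b u w s t
  assume ab: "a \<noteq> 0 \<or> b \<noteq> 0" and h: "homogeneous 1 u" "homogeneous 1 w" "homogeneous 1 s" "homogeneous 1 t"
    and e: "const a * subst v f + const b * subst v g = u * w + s * t"
  have "subst v' (const a * subst v f + const b * subst v g) = subst v' (u * w + s * t)" using e by simp
  then have "const a * f + const b * g = subst v' u * subst v' w + subst v' s * subst v' t"
    by (simp add: subst.hom linear_automorphismD(3)[OF v])
  then show False
    using strong_pencilD[OF C ab] homogeneous_subst[of v', OF linear_automorphismD(2)[OF v]] h by blast
qed

lemma subst_ideal2:
  assumes "p \<in> ideal2 f g"
  shows "subst v p \<in> ideal2 (subst v f) (subst v g)"
proof -
  obtain a b where "p = a * f + b * g" using assms unfolding ideal2_def by blast
  then have "subst v p = subst v a * subst v f + subst v b * subst v g" by (simp add: subst.hom)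
  then show ?thesis unfolding ideal2_def by blast
qed

lemma prime_pair_subst:
  assumes P: "prime_pair (subst v f) (subst v g)" and v: "linear_automorphism v v'"
  shows "prime_pair f g"
  unfolding prime_pair_def
proof (intro allI impI)
  fix u w assume "u * w \<in> ideal2 f g"
  then have "subst v u * subst v w \<in> ideal2 (subst v f) (subst v g)"
    using subst_ideal2[of "u * w" f g v] by (simp add: subst.hom)
  then have "subst v u \<in> ideal2 (subst v f) (subst v g) \<or> subst v w \<in> ideal2 (subst v f) (subst v g)"
    using P unfolding prime_pair_def by blast
  then show "u \<in> ideal2 f g \<or> w \<in> ideal2 f g"
    using subst_ideal2[of "subst v u" "subst v f" "subst v g" v']
      subst_ideal2[of "subst v w" "subst v f" "subst v g" v'] by (auto simp: linear_automorphismD(3)[OF v])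
qed

lemma strong_pencil_commute: "strong_pencil f g \<Longrightarrow> strong_pencil g f"
  unfolding strong_pencil_def by (metis add.commute)

text \<open>Once a zero of \<open>f\<close> is moved to a coordinate point,
  \<open>ternary_quadric\<close> writes the transformed \<open>f\<close>, itself a member of the
  pencil, as two products.\<close>

lemma not_strong_pencil_ternary:
  fixes f g :: "'k::field mpoly"
  assumes k: "alg_closed TYPE('k)" and abc: "a \<noteq> b" and f: "over {a, b, c} f"
  shows "\<not> strong_pencil f g"
proof
  assume C: "strong_pencil f g"
  then have f2: "homogeneous 2 f" using strong_pencil_homogeneous by blast
  obtain e where e: "eval e f = 0" "e a \<noteq> 0 \<or> e b \<noteq> 0" "\<And>i. i \<notin> {a, b} \<Longrightarrow> e i = 0"
    using isotropic_vector[OF k f2 abc] by blast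
  have e3: "\<And>i. i \<notin> {a, b, c} \<Longrightarrow> e i = 0" using e(3) by blast
  have contra: False if nz: "e a' \<noteq> 0" and V: "{a, b, c} = {a', b', c}" for a' b'
  proof -
    obtain v v' where v: "linear_automorphism v v'"
      "\<forall>h. over {a, b, c} h \<longrightarrow> over {a, b, c} (subst v h)"
      "\<forall>h. homogeneous 2 h \<longrightarrow> eval e h = 0 \<longrightarrow> eval (unit_vec a') (subst v h) = 0"
      using coordinate_change[of e a' "{a, b, c}", OF nz e3] .
    have C': "strong_pencil (subst v f) (subst v g)"
      by (rule strong_pencil_subst[OF C v(1)])
    have "homogeneous 2 (subst v f)" using homogeneous_subst[of v, OF linear_automorphismD(1)[OF v(1)] f2] .
    then obtain u w where "subst v f = pvar b' * u + pvar c * w" "homogeneous 1 u" "homogeneous 1 w"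
      using ternary_quadric[of "subst v f" a' b' c] v(2)[rule_format, OF f] v(3)[rule_format, OF f2 e(1)] V by metis
    then show False
      using strong_pencilD[OF C', of 1 0 "pvar b'" u "pvar c" w] by (simp add: const.hom)
  qed
  from e(2) show False
    using contra[of a b] contra[of b a] by (metis insert_commute)
qed

text \<open>The decomposition at a common zero settles everything except \<open>l1 = l2 = 0\<close>,
  where both quadrics are cones free of \<open>x\<close>; these are left to the induction on the
  number of variables.\<close>

lemma prime_pair_strong_pencil:
  fixes f g :: "'k::field mpoly"
  assumes k: "alg_closed TYPE('k)" and "finite V" "over V f" "over V g" "strong_pencil f g"
  shows "prime_pair f g"
  using assms(2-)
proof (induction "card V" arbitrary: V f g rule: less_induct)
  case less
  note fV = less.prems(1) and ov = less.prems(2,3) and C = less.prems(4)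
  have fg: "homogeneous 2 f" "homogeneous 2 g" using strong_pencil_homogeneous[OF C] by auto
  have card4: "4 \<le> card V"
  proof (rule ccontr)
    assume "\<not> ?thesis"
    then have c3: "card V + (3 - card V) = 3" by simp
    obtain K where K: "finite K" "card K = 3 - card V" "K \<subseteq> - V"
      using infinite_arbitrarily_large[of "- V" "3 - card V"] fV by (auto simp: Compl_eq_Diff_UNIV)
    have "card (V \<union> K) = card V + card K" by (rule card_Un_disjoint) (use fV K in auto)
    then have V': "card (V \<union> K) = 3" "V \<subseteq> V \<union> K" using K(2) c3 by simp_all
    then obtain a b c where "V \<union> K = {a, b, c}" "a \<noteq> b" by (auto simp: card_3_iff)
    then show False using not_strong_pencil_ternary[OF k, of a b c f g] over_mono[OF ov(1) V'(2)] C by simp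
  qed
  then obtain T where T: "T \<subseteq> V" "card T = 4" "finite T" by (meson obtain_subset_with_card_n)
  obtain xs where xs: "set xs = T" "distinct xs" using finite_distinct_list[OF T(3)] by blast
  then have "length xs = 4" using T(2) distinct_card by metis
  then obtain a b c d where abcd: "xs = [a, b, c, d]"
    by (auto simp: length_Suc_conv eval_nat_numeral)
  have abcdV: "distinct [a, b, c, d]" "{a, b, c, d} \<subseteq> V" using xs abcd T(1) by auto
  obtain p where p: "eval p f = 0" "eval p g = 0" "p \<noteq> (\<lambda>_. 0)" "\<And>i. i \<notin> V \<Longrightarrow> p i = 0"
    by (rule common_zero[OF k fg abcdV]) blast
  then obtain x where x: "p x \<noteq> 0" by blast
  then have xV: "x \<in> V" using p(4) by blast
  obtain v v' where v: "linear_automorphism v v'"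
    "\<forall>h. over V h \<longrightarrow> over V (subst v h)"
    "\<forall>h. homogeneous 2 h \<longrightarrow> eval p h = 0 \<longrightarrow> eval (unit_vec x) (subst v h) = 0"
    using coordinate_change[of p x V, OF x p(4)] .
  have C': "strong_pencil (subst v f) (subst v g)"
    by (rule strong_pencil_subst[OF C v(1)])
  have h': "homogeneous 2 (subst v f)" "homogeneous 2 (subst v g)"
    using strong_pencil_homogeneous[OF C'] by auto
  obtain l1 q1 where 1: "subst v f = pvar x * l1 + q1" "homogeneous 1 l1" "homogeneous 2 q1"
    "over (V - {x}) l1" "over (V - {x}) q1"
    by (rule quadric_decompose[OF h'(1) v(2)[rule_format, OF ov(1)] v(3)[rule_format, OF fg(1) p(1)]])
  obtain l2 q2 where 2: "subst v g = pvar x * l2 + q2" "homogeneous 1 l2" "homogeneous 2 q2"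
    "over (V - {x}) l2" "over (V - {x}) q2"
    by (rule quadric_decompose[OF h'(2) v(2)[rule_format, OF ov(2)] v(3)[rule_format, OF fg(2) p(2)]])
  have free: "over (- {x}) l1" "over (- {x}) l2" "over (- {x}) q1" "over (- {x}) q2"
    using 1 2 over_mono[of "V - {x}" _ "- {x}"] by auto
  have "prime_pair (subst v f) (subst v g)"
  proof (cases "l1 = 0")
    case l1: True
    show ?thesis
    proof (cases "l2 = 0")
      case True
      have "card (V - {x}) < card V" by (rule card_Diff1_less[OF fV xV])
      then show ?thesis
        using less.hyps[of "V - {x}" "subst v f" "subst v g"] fV 1 2 l1 True C' by simp
    next
      case False
      \<comment> \<open>Elimination needs a nonzero first linear form, so the quadrics change
        places.\<close>
      have "strong_pencil (pvar x * l2 + q2) (pvar x * l1 + q1)"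
        using strong_pencil_commute[OF C'] unfolding 1(1) 2(1) .
      then have "prime_pair (pvar x * l2 + q2) (pvar x * l1 + q1)"
        using prime_pair_decomposed[OF _ 2(2) 1(2) 2(3) 1(3) free(2,1,4,3) False] by blast
      then show ?thesis unfolding 1(1) 2(1) prime_pair_def by (metis ideal2_commute)
    qed
  next
    case False
    then show ?thesis
      using prime_pair_decomposed[OF _ 1(2) 2(2) 1(3) 2(3) free] C' unfolding 1(1) 2(1) by blast
  qed
  then show ?case by (rule prime_pair_subst[OF _ v(1)])
qed

section \<open>The regular sequence\<close>

lemma in_ring_iff_over: "in_ring n p \<longleftrightarrow> over {..<n} p"
  by (simp add: in_ring_def over_def)

text \<open>A retraction onto the polynomials in the first \<open>n\<close> variables: identities
  whose coefficients contain stray variables become identities inside the given ring.\<close>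

definition restr :: "nat \<Rightarrow> 'a::comm_ring_1 mpoly \<Rightarrow> 'a mpoly" where
  "restr n = subst (\<lambda>i. if i < n then pvar i else 0)"

lemma rhom_restr: "rhom (restr n)"
  unfolding restr_def by (rule subst.rhom_axioms)

lemma restr_id: "in_ring n p \<Longrightarrow> restr n p = p"
  unfolding in_ring_iff_over restr_def by (erule subst_id_on) simp

lemma in_ring_restr: "in_ring n (restr n p)"
  unfolding in_ring_iff_over restr_def by (rule over_subst[OF over_UNIV]) auto

lemma homogeneous_restr: "homogeneous d p \<Longrightarrow> homogeneous d (restr n p)"
  unfolding restr_def by (rule homogeneous_subst) auto

lemma in_ideal2_restrict:
  assumes "p \<in> ideal2 f g" "in_ring n p" "in_ring n f" "in_ring n g"
  obtains a b where "p = a * f + b * g" "in_ring n a" "in_ring n b"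
proof -
  obtain a b where "p = a * f + b * g" using assms(1) unfolding ideal2_def by blast
  then have "restr n p = restr n a * restr n f + restr n b * restr n g"
    by (simp add: rhom.add[OF rhom_restr] rhom.mult[OF rhom_restr])
  then show thesis using that[of "restr n a" "restr n b"] assms(2-) by (simp add: restr_id in_ring_restr)
qed

text \<open>Strength 1 allows two products, hence the \<open>nat 1 + 1\<close> terms. The linear
  forms may contain stray variables, which \<open>restr\<close> removes without changing
  \<open>p\<close>.\<close>

lemma strength_le_1I:
  fixes p :: "'k::comm_ring_1 mpoly"
  assumes p: "in_ring n p" "p = u * v + s * t"
    and h: "homogeneous 1 u" "homogeneous 1 v" "homogeneous 1 s" "homogeneous 1 t"
  shows "strength_le n p 1"
proof -
  let ?g = "\<lambda>i::nat. restr n (if i = 0 then u else s)" and ?h = "\<lambda>i::nat. restr n (if i = 0 then v else t)"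
  have hp: "hom_pos (restr n u)" if "homogeneous 1 u" for u :: "'k mpoly"
    unfolding hom_pos_def using homogeneous_restr[OF that] zero_less_one by blast
  have "restr n p = restr n u * restr n v + restr n s * restr n t"
    unfolding p(2) by (simp add: rhom.add[OF rhom_restr] rhom.mult[OF rhom_restr])
  then have "p = (\<Sum>i < nat 1 + 1. ?g i * ?h i)"
    using p(1) by (simp add: restr_id numeral_2_eq_2)
  moreover have "\<forall>i < nat 1 + 1. in_ring n (?g i) \<and> in_ring n (?h i) \<and> hom_pos (?g i) \<and> hom_pos (?h i)"
    using h by (auto simp: in_ring_restr intro: hp)
  ultimately have "\<exists>g h :: nat \<Rightarrow> 'k mpoly.
      (\<forall>i < nat 1 + 1. in_ring n (g i) \<and> in_ring n (h i) \<and> hom_pos (g i) \<and> hom_pos (h i)) \<and>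
      p = (\<Sum>i < nat 1 + 1. g i * h i)"
    by (intro exI[of _ ?g] exI[of _ ?h] conjI)
  then show ?thesis unfolding strength_le_def by simp
qed

text \<open>Compare components of degree 2: only the constant terms of the two coefficients
  contribute.\<close>

lemma quadric_in_ideal2:
  fixes f g h :: "'k::field mpoly"
  assumes "h \<in> ideal2 f g" "homogeneous 2 f" "homogeneous 2 g" "homogeneous 2 h"
  obtains a b where "h = const a * f + const b * g"
proof -
  obtain a b where ab: "h = a * f + b * g" using assms(1) unfolding ideal2_def by blast
  have c: "coeff (grade (p * q)) 2 = coeff (grade p) 0 * q" if "homogeneous 2 q" for p q :: "'k mpoly"
  proof -
    have "grade (p * q) = monom q 2 * grade p"
      using that by (simp add: homogeneous_iff_grade grade.mult mult.commute)
    then show ?thesis by (simp only: coeff_monom_mult) (simp add: mult.commute)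
  qed
  have "h = coeff (grade h) 2" using assms(4) by (simp add: homogeneous_iff_grade)
  also have "\<dots> = coeff (grade a) 0 * f + coeff (grade b) 0 * g"
    unfolding ab grade.add coeff_add using c assms by simp
  finally have "h = coeff (grade a) 0 * f + coeff (grade b) 0 * g" .
  moreover obtain \<alpha> where "coeff (grade a) 0 = const \<alpha>"
    using homogeneous_coeff_grade[of 0 a] by (auto simp: homogeneous_0_iff)
  moreover obtain \<beta> where "coeff (grade b) 0 = const \<beta>"
    using homogeneous_coeff_grade[of 0 b] by (auto simp: homogeneous_0_iff)
  ultimately show thesis using that by simp
qed

lemma eval_zero_quadric:
  fixes f :: "'k::field mpoly"
  assumes "homogeneous 2 f"
  shows "eval (\<lambda>_. 0) f = 0"
proof -
  obtain B where "polar_form f B" by (rule quadratic_map[OF assms])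
  from polar_formD(1)[OF this, of 0 "\<lambda>_. 0" 0 "\<lambda>_. 0"] show ?thesis by simp
qed

theorem theorem5p3:
  fixes n :: nat and f :: "nat \<Rightarrow> 'k::field mpoly"
  assumes "alg_closed TYPE('k)"
    and "(2::'k) \<noteq> 0"
    and "\<forall>i<3. in_ring n (f i) \<and> homogeneous 2 (f i)"
    and "collective_strength_ge n 3 f 2"
  shows "regular_seq n 3 f"
proof -
  have f: "in_ring n (f 0)" "in_ring n (f 1)" "in_ring n (f 2)"
    "homogeneous 2 (f 0)" "homogeneous 2 (f 1)" "homogeneous 2 (f 2)"
    using assms(3) by auto
  have sum3: "(\<Sum>i<3. g i) = g 0 + g 1 + g 2" for g :: "nat \<Rightarrow> 'k mpoly"
    by (simp add: numeral_3_eq_3 numeral_2_eq_2)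
  \<comment> \<open>Collective strength at least 2 denies strength at most \<open>2 - 1\<close>, in
    particular any sum of two products of linear forms.\<close>
  have no: "const a * f 0 + const b * f 1 + const c * f 2 \<noteq> u * v + s * t"
    if "a \<noteq> 0 \<or> b \<noteq> 0 \<or> c \<noteq> 0"
      "homogeneous 1 u" "homogeneous 1 v" "homogeneous 1 s" "homogeneous 1 t" for a b c u v s t
  proof
    assume e: "const a * f 0 + const b * f 1 + const c * f 2 = u * v + s * t"
    define d :: "nat \<Rightarrow> 'k" where "d = (\<lambda>i. if i = 0 then a else if i = 1 then b else c)"
    have s: "(\<Sum>i<3. const (d i) * f i) = const a * f 0 + const b * f 1 + const c * f 2"
      unfolding sum3 by (simp add: d_def)
    have "in_ring n (\<Sum>i<3. const (d i) * f i)"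
      using f unfolding sum3 in_ring_iff_over by (intro over_add over_mult over_const)
    then have "strength_le n (\<Sum>i<3. const (d i) * f i) 1"
      using strength_le_1I[OF _ _ that(2-5)] s e by metis
    moreover have "\<exists>i<3. d i \<noteq> 0"
    proof -
      have "d 0 \<noteq> 0 \<or> d 1 \<noteq> 0 \<or> d 2 \<noteq> 0" using that(1) by (simp add: d_def)
      moreover have "0 < (3::nat)" "1 < (3::nat)" "2 < (3::nat)" by simp_all
      ultimately show ?thesis by blast
    qed
    ultimately show False using assms(4) unfolding collective_strength_ge_def by simp
  qed
  have C: "strong_pencil (f 0) (f 1)"
    unfolding strong_pencil_def using f no[of _ _ 0] by (simp add: const.zero)
  have P: "prime_pair (f 0) (f 1)"
    by (rule prime_pair_strong_pencil[OF assms(1) finite_lessThan[of n] _ _ C])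
      (use f in \<open>simp_all add: in_ring_iff_over\<close>)
  have "f 0 \<noteq> u * v" if "homogeneous 1 u" "homogeneous 1 v" for u v
    using no[of 1 0 0 u v 0 0] that by (simp add: const.hom)
  then have p0: "prime_elem (f 0)"
    by (intro irreducible_imp_prime_elem_mpoly irreducible_quadric[OF f(4)])
  then have f0: "f 0 \<noteq> 0" by (rule prime_elem_not_zeroI)
  have nd: "\<not> f 0 dvd f 1"
  proof
    assume "f 0 dvd f 1"
    then obtain c where "f 1 = const c * f 0" by (rule homogeneous_dvd_same[OF f(4) f0 f(5)])
    \<comment> \<open>Proportional quadrics give the zero combination, itself a sum of products of
      zero forms.\<close>
    then show False using no[of "- c" 1 0 0 0 0 0] by (simp add: const.hom)
  qed
  have nf2: "f 2 \<notin> ideal2 (f 0) (f 1)"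
  proof
    assume "f 2 \<in> ideal2 (f 0) (f 1)"
    then obtain a b where "f 2 = const a * f 0 + const b * f 1"
      by (rule quadric_in_ideal2[OF _ f(4-6)])
    then show False using no[of "- a" "- b" 1 0 0 0 0] by (simp add: const.hom)
  qed
  have one: "1 \<notin> gen_ideal n 3 f"
  proof
    assume "1 \<in> gen_ideal n 3 f"
    then obtain a where "1 = (\<Sum>i<3. a i * f i)" unfolding gen_ideal_def by blast
    \<comment> \<open>The quadrics vanish at the origin, the constant 1 does not.\<close>
    then have "eval (\<lambda>_. 0) 1 = eval (\<lambda>_. 0) (\<Sum>i<3. a i * f i)" by simp
    then show False using f by (simp add: sum3 eval.hom eval_zero_quadric)
  qed
  have "g \<in> gen_ideal n i f" if i: "i < 3" and g: "in_ring n g" "f i * g \<in> gen_ideal n i f" for i g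
  proof -
    consider "i = 0" | "i = 1" | "i = 2" using i by linarith
    then show ?thesis
    proof cases
      case 1
      then have "f 0 * g = 0" using g(2) by (auto simp: gen_ideal_def)
      then show ?thesis using f0 1 by (auto simp: gen_ideal_def)
    next
      case 2
      then obtain a where "f 1 * g = a * f 0" using g(2) by (auto simp: gen_ideal_def)
      then have "f 0 dvd f 1 * g" by simp
      then have "f 0 dvd g" using p0 nd by (simp add: prime_elem_dvd_mult_iff)
      then obtain h where h: "g = f 0 * h" by (rule dvdE)
      \<comment> \<open>The cofactor \<open>h\<close> comes from divisibility in the large ring;
        restriction replaces it by one in the first \<open>n\<close> variables.\<close>
      then have "restr n g = restr n (f 0) * restr n h" by (simp add: rhom.mult[OF rhom_restr])
      then have "g = restr n h * f 0" using g(1) f(1) by (simp add: restr_id mult.commute)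
      then show ?thesis
        unfolding gen_ideal_def 2 by (auto intro!: exI[of _ "\<lambda>_. restr n h"] simp: in_ring_restr)
    next
      case 3
      then obtain a b where "f 2 * g = a * f 0 + b * f 1"
        using g(2) by (auto simp: gen_ideal_def numeral_2_eq_2)
      then have "f 2 * g \<in> ideal2 (f 0) (f 1)" unfolding ideal2_def by blast
      then have "g \<in> ideal2 (f 0) (f 1)" using P nf2 unfolding prime_pair_def by blast
      then obtain a b where ab: "g = a * f 0 + b * f 1" "in_ring n a" "in_ring n b"
        using in_ideal2_restrict[OF _ g(1) f(1,2)] by blast
      then show ?thesis
        unfolding gen_ideal_def 3
        by (auto intro!: exI[of _ "\<lambda>i. if i = 0 then a else b"] simp: numeral_2_eq_2)
    qed
  qed
  then show ?thesis unfolding regular_seq_def using one by blast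
qed

end
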